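(* Let $T=(V,E)$ be a finite tree with at least two vertices whose edges carry $s\times s$ real matrix weights $W(e)$ belonging to one of the following classes: (1) all weights $W(e)$ are (symmetric) positive definite matrices; (2) all weights $W(e)$ are lower triangular matrices with positive diagonal entries (or all are upper triangular matrices with positive diagonal entries). If $x\in V$ is not a characteristic-like vertex of $T$, then there is a unique Perron branch at $x$ in $T$, and it is the branch at $x$ which contains the characteristic-like vertex (or vertices) of $T$.
   Context: Laplacian: for a tree $T=(V,E)$ on $n$ vertices with $s\times s$ matrix edge weights, $L=[l_{uv}]_{u,v\in V}$ is the $ns\times ns$ block matrix whose $s\times s$ blocks are: for $u\ne v$, $l_{uv}=-W(e)$ if $u,v$ are joined by the edge $e$, and $l_{uv}=\mathbf 0$ if $u,v$ are not adjacent; $l_{vv}$ is the sum of the weights of the edges incident with $v$. For $v\in V$, $L_v$ is $L$ with the row block and column block of $v$ deleted. When all weights are nonsingular, $L_v$ is invertible; put $M_v=L_v^{-1}$. A branch at $v$ is a connected component of the graph obtained from $T$ by deleting $v$ and its incident edges; $B_v(u)$ is the branch at $v$ containing $u$ ($u\neq v$). $M_v$ is block diagonal with one diagonal block $M_v(B)$, the bottleneck matrix of $B$ at $v$, for each branch $B$ at $v$; for $x,y\in B$ the $(x,y)$ block of $M_v(B)$ is $\sum_{e\in \mathcal P(x,v)\cap\mathcal P(y,v)}W(e)^{-1}$, where $\mathcal P(a,b)$ is the path joining $a$ and $b$. Write $\rho(\cdot)$ for spectral radius. A branch $B$ at $v$ is a Perron branch at $v$ if $\rho(M_v(B))=\rho(M_v)$,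 equivalently if $\rho(M_v(B))$ is the largest among all branches at $v$. Characteristic-like vertices: for a finite tree $T$ with at least two vertices whose $s\times s$ real matrix edge weights are either all (symmetric) positive definite, or all lower triangular with positive diagonal entries, or all upper triangular with positive diagonal entries, one of two cases occurs. Case 1: there is a unique vertex $v$ at which there are two or more Perron branches; then $v$ is called the characteristic-like vertex of $T$. Case 2: there is a unique pair of adjacent vertices $u\sim v$ such that $B_u(v)$ is the unique Perron branch at $u$ and $B_v(u)$ is the unique Perron branch at $v$; then the edge $uv$ is called the characteristic-like edge, and $u,v$ are the characteristic-like vertices of $T$. *)

theory Defs
  imports
    "Graph_Theory.Digraph_Component"
    "Jordan_Normal_Form.Spectral_Radius"
    "Jordan_Normal_Form.DL_Submatrix"
begin

text \<open>
  A finite simple graph is a symmetric, loop-free digraph without parallel arcs (locale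
  \<^term>\<open>graph\<close> of the Graph Theory library), so every undirected edge is a pair of opposite
  arcs and the walk \<open>u, v, u\<close> counts as a cycle of length 2. Trees are therefore the
  connected graphs all of whose cycles have length at most 2. The constant \<open>tree\<close> of the
  library forbids these 2-cycles as well and is meant for oriented trees.
\<close>

definition finite_tree :: "('v, 'e) pre_digraph \<Rightarrow> bool" where
  "finite_tree G \<longleftrightarrow> graph G \<and> Digraph_Component.connected G \<and>
     (\<forall>p. pre_digraph.cycle G p \<longrightarrow> length p \<le> 2)"

definition branches :: "('v, 'e) pre_digraph \<Rightarrow> 'v \<Rightarrow> 'v set set" where
  "branches G v = pre_digraph.sccs_verts (pre_digraph.del_vert G v)"

text \<open>The branch \<open>B\<^sub>v(u)\<close> at \<open>v\<close> containing \<open>u \<noteq> v\<close>.\<close>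

definition branch_of :: "('v, 'e) pre_digraph \<Rightarrow> 'v \<Rightarrow> 'v \<Rightarrow> 'v set" where
  "branch_of G v u = pre_digraph.scc_of (pre_digraph.del_vert G v) u"

definition positive_definite :: "nat \<Rightarrow> real mat \<Rightarrow> bool" where
  "positive_definite s A \<longleftrightarrow> A \<in> carrier_mat s s \<and> transpose_mat A = A \<and>
     (\<forall>y \<in> carrier_vec s. y \<noteq> 0\<^sub>v s \<longrightarrow> 0 < y \<bullet> (A *\<^sub>v y))"

definition upper_triangular_pos :: "nat \<Rightarrow> real mat \<Rightarrow> bool" where
  "upper_triangular_pos s A \<longleftrightarrow> A \<in> carrier_mat s s \<and> upper_triangular A \<and>
     (\<forall>i<s. 0 < A $$ (i, i))"

definition lower_triangular_pos :: "nat \<Rightarrow> real mat \<Rightarrow> bool" where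
  "lower_triangular_pos s A \<longleftrightarrow> A \<in> carrier_mat s s \<and>
     (\<forall>i<s. \<forall>j<s. i < j \<longrightarrow> A $$ (i, j) = 0) \<and> (\<forall>i<s. 0 < A $$ (i, i))"

text \<open>
  The weight function takes an undirected edge, given as the set of its two ends.
  Its values on other sets are irrelevant.
\<close>

definition edges :: "('v, 'e) pre_digraph \<Rightarrow> 'v set set" where
  "edges G = {{u, v} | u v. u \<rightarrow>\<^bsub>G\<^esub> v}"

definition admissible_weights ::
    "('v, 'e) pre_digraph \<Rightarrow> nat \<Rightarrow> ('v set \<Rightarrow> real mat) \<Rightarrow> bool" where
  "admissible_weights G s W \<longleftrightarrow>
     (\<forall>e \<in> edges G. positive_definite s (W e)) \<or>
     (\<forall>e \<in> edges G. lower_triangular_pos s (W e)) \<or>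
     (\<forall>e \<in> edges G. upper_triangular_pos s (W e))"

definition laplacian_block ::
    "('v, 'e) pre_digraph \<Rightarrow> nat \<Rightarrow> ('v set \<Rightarrow> real mat) \<Rightarrow> 'v \<Rightarrow> 'v \<Rightarrow> real mat" where
  "laplacian_block G s W u v =
     (if u = v then mat s s (\<lambda>(i, j). \<Sum>e \<in> {e \<in> edges G. v \<in> e}. W e $$ (i, j))
      else if {u, v} \<in> edges G then - W {u, v}
      else 0\<^sub>m s s)"

text \<open>
  Matrices indexed by \<open>V\<close> need an ordering of the vertices: \<open>vs\<close> lists them without
  repetition, and position \<open>p\<close> of a block matrix belongs to the vertex \<open>vs ! (p div s)\<close> and
  to the index \<open>p mod s\<close> inside its block.
\<close>

definition laplacian ::
    "('v, 'e) pre_digraph \<Rightarrow> nat \<Rightarrow> ('v set \<Rightarrow> real mat) \<Rightarrow> 'v list \<Rightarrow> real mat" where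
  "laplacian G s W vs = mat (length vs * s) (length vs * s)
     (\<lambda>(p, q). laplacian_block G s W (vs ! (p div s)) (vs ! (q div s)) $$ (p mod s, q mod s))"

definition block_positions :: "nat \<Rightarrow> 'v list \<Rightarrow> 'v set \<Rightarrow> nat set" where
  "block_positions s vs S = {p. p < length vs * s \<and> vs ! (p div s) \<in> S}"

definition principal_blocks :: "nat \<Rightarrow> 'v list \<Rightarrow> 'v set \<Rightarrow> real mat \<Rightarrow> real mat" where
  "principal_blocks s vs S A =
     submatrix A (block_positions s vs S) (block_positions s vs S)"

text \<open>\<open>L\<^sub>v\<close> and \<open>M\<^sub>v = L\<^sub>v\<^sup>-\<^sup>1\<close>\<close>

definition reduced_laplacian ::
    "('v, 'e) pre_digraph \<Rightarrow> nat \<Rightarrow> ('v set \<Rightarrow> real mat) \<Rightarrow> 'v list \<Rightarrow> 'v \<Rightarrow> real mat" where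
  "reduced_laplacian G s W vs v = principal_blocks s vs (- {v}) (laplacian G s W vs)"

definition inverse_reduced_laplacian ::
    "('v, 'e) pre_digraph \<Rightarrow> nat \<Rightarrow> ('v set \<Rightarrow> real mat) \<Rightarrow> 'v list \<Rightarrow> 'v \<Rightarrow> real mat" where
  "inverse_reduced_laplacian G s W vs v = the (mat_inverse (reduced_laplacian G s W vs v))"

text \<open>
  \<open>M\<^sub>v(B)\<close> is the diagonal block of \<open>M\<^sub>v\<close> belonging to the branch \<open>B\<close>; the block rows of
  \<open>M\<^sub>v\<close> follow the ordering \<open>vs\<close> with \<open>v\<close> removed.
\<close>

definition bottleneck_matrix ::
    "('v, 'e) pre_digraph \<Rightarrow> nat \<Rightarrow> ('v set \<Rightarrow> real mat) \<Rightarrow> 'v list \<Rightarrow> 'v \<Rightarrow> 'v set \<Rightarrow> real mat"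
where
  "bottleneck_matrix G s W vs v B =
     principal_blocks s (removeAll v vs) B (inverse_reduced_laplacian G s W vs v)"

definition real_spectral_radius :: "real mat \<Rightarrow> real" where
  "real_spectral_radius A = spectral_radius (map_mat complex_of_real A)"

definition perron_branches ::
    "('v, 'e) pre_digraph \<Rightarrow> nat \<Rightarrow> ('v set \<Rightarrow> real mat) \<Rightarrow> 'v list \<Rightarrow> 'v \<Rightarrow> 'v set set" where
  "perron_branches G s W vs v = {B \<in> branches G v.
     real_spectral_radius (bottleneck_matrix G s W vs v B) =
     real_spectral_radius (inverse_reduced_laplacian G s W vs v)}"

definition multi_perron ::
    "('v, 'e) pre_digraph \<Rightarrow> nat \<Rightarrow> ('v set \<Rightarrow> real mat) \<Rightarrow> 'v list \<Rightarrow> 'v \<Rightarrow> bool" where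
  "multi_perron G s W vs v \<longleftrightarrow> v \<in> verts G \<and> 2 \<le> card (perron_branches G s W vs v)"

definition facing_pair ::
    "('v, 'e) pre_digraph \<Rightarrow> nat \<Rightarrow> ('v set \<Rightarrow> real mat) \<Rightarrow> 'v list \<Rightarrow> 'v \<Rightarrow> 'v \<Rightarrow> bool" where
  "facing_pair G s W vs u v \<longleftrightarrow> {u, v} \<in> edges G \<and>
     perron_branches G s W vs u = {branch_of G u v} \<and>
     perron_branches G s W vs v = {branch_of G v u}"

text \<open>Uniqueness of the pair in the second case is that of the unordered pair.\<close>

definition characteristic_like_vertices ::
    "('v, 'e) pre_digraph \<Rightarrow> nat \<Rightarrow> ('v set \<Rightarrow> real mat) \<Rightarrow> 'v list \<Rightarrow> 'v set" where
  "characteristic_like_vertices G s W vs =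
     {v. multi_perron G s W vs v \<and> (\<forall>w. multi_perron G s W vs w \<longrightarrow> w = v)} \<union>
     {u. \<exists>v. facing_pair G s W vs u v \<and>
           (\<forall>u' v'. facing_pair G s W vs u' v' \<longrightarrow> {u', v'} = {u, v})}"

end

theory Submission
  imports Defs "HOL-Analysis.Function_Topology"
begin

text \<open>
  Two ideas carry the proof.

  The first is combinatorial. Suppose every connected proper subset \<open>S\<close> of the tree has a value that
  increases strictly with \<open>S\<close>, and call a branch at \<open>v\<close> Perron if its value is the largest at \<open>v\<close>. If a
  Perron branch at \<open>v\<close> avoids \<open>x\<close>, then at \<open>x\<close> the direction of \<open>v\<close> is the only Perron direction
  (\<open>perron_towards\<close>): a branch at \<open>x\<close> in another direction is properly contained in the branch at
  \<open>v\<close> containing \<open>x\<close>, whose value is at most that of the given Perron branch, and the latter is properly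
  contained in the branch at \<open>x\<close> towards \<open>v\<close>. A vertex with two Perron branches always has one
  avoiding \<open>x\<close>. If there is no such vertex, two adjacent vertices point at each other
  (\<open>facing_exists\<close>), and from any third vertex \<open>x\<close> one of the two Perron branches avoids \<open>x\<close>. The same
  argument shows that the vertex or the edge is unique (\<open>multi_unique\<close>, \<open>facing_unique\<close>).

  The second idea shows that the spectral radius of the bottleneck matrix is such a value. The
  reduced Laplacian is block diagonal over the branches, so the bottleneck matrix of \<open>B\<close> is the inverse of
  the block of the Laplacian on \<open>B\<close>, and its spectral radius is the largest reciprocal modulus of an
  eigenvalue of that block (\<open>spectral_radii\<close>). For positive definite weights it is the
  reciprocal of the minimum of the Rayleigh quotient. Extension by zero shows that this minimum does not
  increase with the set. In case of equality the extended minimiser is an eigenvector on the larger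
  set; a vertex \<open>w\<close> outside the smaller set meets it in a single neighbour \<open>r\<close>, so the row at \<open>w\<close> says that
  the minimiser vanishes at \<open>r\<close>. But a minimiser on a connected set of a tree vanishes at no vertex
  (\<open>ground_state_nonvanishing\<close>). This yields strictness (\<open>ground_state_strict_mono\<close>).

  For triangular weights the spectrum of each block is the union of the spectra of the scalar
  Laplacians formed from the diagonal entries (\<open>spectral_point_iff_scalar\<close>), and strict
  monotonicity is inherited from the case of positive scalar weights.
\<close>

section \<open>Branches of an abstract tree\<close>

text \<open>Acyclicity is recorded in the form in which it is used throughout: a vertex has at most one
  neighbour in a connected set that does not contain it.\<close>

locale abstract_tree =
  fixes V :: "'v set" and adj :: "'v \<Rightarrow> 'v \<Rightarrow> bool"
  assumes finite_V: "finite V"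
    and adj_sym: "adj x y \<Longrightarrow> adj y x"
    and adj_irrefl: "\<not> adj x x"
    and adj_in_V: "adj x y \<Longrightarrow> x \<in> V"
    and walk_V: "x \<in> V \<Longrightarrow> y \<in> V \<Longrightarrow> (\<lambda>a b. a \<in> V \<and> b \<in> V \<and> adj a b)\<^sup>*\<^sup>* x y"
    and unique_attachment: "\<lbrakk>\<And>x y. x \<in> C \<Longrightarrow> y \<in> C \<Longrightarrow> (\<lambda>a b. a \<in> C \<and> b \<in> C \<and> adj a b)\<^sup>*\<^sup>* x y;
       C \<subseteq> V; w \<notin> C; c \<in> C; c' \<in> C; adj w c; adj w c'\<rbrakk> \<Longrightarrow> c = c'"
begin

definition walk_in :: "'v set \<Rightarrow> 'v \<Rightarrow> 'v \<Rightarrow> bool" where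
  "walk_in S = (\<lambda>a b. a \<in> S \<and> b \<in> S \<and> adj a b)\<^sup>*\<^sup>*"

definition connected_set :: "'v set \<Rightarrow> bool" where
  "connected_set S \<longleftrightarrow> (\<forall>x\<in>S. \<forall>y\<in>S. walk_in S x y)"

definition component :: "'v set \<Rightarrow> 'v \<Rightarrow> 'v set" where
  "component S x = {y \<in> S. walk_in S x y}"

abbreviation branch :: "'v \<Rightarrow> 'v \<Rightarrow> 'v set" where
  "branch v u \<equiv> component (V - {v}) u"

definition branches_at :: "'v \<Rightarrow> 'v set set" where
  "branches_at v = branch v ` (V - {v})"

lemma adj_in_V2: "adj x y \<Longrightarrow> y \<in> V"
  using adj_in_V adj_sym by blast

lemma connected_V: "connected_set V"
  using walk_V by (auto simp: connected_set_def walk_in_def)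

lemma attach: "\<lbrakk>connected_set C; C \<subseteq> V; w \<notin> C; c \<in> C; c' \<in> C; adj w c; adj w c'\<rbrakk> \<Longrightarrow> c = c'"
  by (rule unique_attachment[of C]) (auto simp: connected_set_def walk_in_def)

lemma walk_in_refl [simp]: "walk_in S x x"
  by (simp add: walk_in_def)

lemma walk_in_step: "walk_in S x y \<Longrightarrow> y \<in> S \<Longrightarrow> z \<in> S \<Longrightarrow> adj y z \<Longrightarrow> walk_in S x z"
  unfolding walk_in_def by (rule rtranclp.rtrancl_into_rtrancl) auto

lemma walk_in_trans: "walk_in S x y \<Longrightarrow> walk_in S y z \<Longrightarrow> walk_in S x z"
  unfolding walk_in_def by (rule rtranclp_trans)

lemma walk_in_sym: "walk_in S x y \<Longrightarrow> walk_in S y x"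
  unfolding walk_in_def
proof (induction rule: rtranclp_induct)
  case (step y z)
  have "(\<lambda>a b. a \<in> S \<and> b \<in> S \<and> adj a b) z y" using step.hyps adj_sym by auto
  then show ?case using step.IH by (rule converse_rtranclp_into_rtranclp)
qed auto

lemma walk_in_mono: "walk_in S x y \<Longrightarrow> S \<subseteq> T \<Longrightarrow> walk_in T x y"
  unfolding walk_in_def by (erule rtranclp_mono[THEN predicate2D, rotated]) auto

lemma component_subset: "component S x \<subseteq> S"
  by (auto simp: component_def)

lemma component_self: "x \<in> S \<Longrightarrow> x \<in> component S x"
  by (auto simp: component_def)

lemma component_step: "y \<in> component S x \<Longrightarrow> z \<in> S \<Longrightarrow> adj y z \<Longrightarrow> z \<in> component S x"
  by (auto simp: component_def intro: walk_in_step)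

lemma component_eq: "y \<in> component S x \<Longrightarrow> component S y = component S x"
  by (auto simp: component_def intro: walk_in_trans walk_in_sym)

lemma connected_set_component: "connected_set (component S x)"
proof -
  have from_x: "walk_in (component S x) x y" if "walk_in S x y" "x \<in> S" for y
    using that(1) unfolding walk_in_def[of S]
  proof (induction rule: rtranclp_induct)
    case (step y z)
    have "walk_in S x y" using step.hyps(1) by (simp add: walk_in_def)
    then have "y \<in> component S x" using step.hyps(2) by (simp add: component_def)
    then show ?case using step by (blast intro: walk_in_step component_step)
  qed simp
  show ?thesis
  proof (cases "x \<in> S")
    case True
    then show ?thesis unfolding connected_set_def
      using from_x by (auto simp: component_def intro: walk_in_trans walk_in_sym)
  next
    case False
    have "y = x" if "walk_in S x y" for y
      using that False unfolding walk_in_def by (auto elim: converse_rtranclpE)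
    then have "component S x = {}" using False by (auto simp: component_def)
    then show ?thesis by (simp add: connected_set_def)
  qed
qed

lemma connected_subset_component:
  "connected_set C \<Longrightarrow> C \<subseteq> S \<Longrightarrow> c \<in> C \<Longrightarrow> C \<subseteq> component S c"
  by (auto simp: connected_set_def component_def intro: walk_in_mono)

lemma connected_set_insert:
  assumes "connected_set C" "c \<in> C" "adj c x"
  shows "connected_set (insert x C)"
proof -
  have *: "walk_in (insert x C) x y" if "y \<in> insert x C" for y
  proof (cases "y = x")
    case False
    then have "walk_in (insert x C) c y"
      using that assms by (auto simp: connected_set_def intro: walk_in_mono)
    moreover have "walk_in (insert x C) x c"
      by (rule walk_in_step[OF walk_in_refl]) (use assms adj_sym in auto)
    ultimately show ?thesis by (rule walk_in_trans[rotated])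
  qed simp
  then show ?thesis unfolding connected_set_def by (blast intro: walk_in_trans walk_in_sym)
qed

lemma boundary:
  assumes "connected_set T" "S \<subseteq> T" "S \<noteq> {}" "S \<noteq> T"
  obtains w r where "w \<in> T - S" "r \<in> S" "adj w r"
proof -
  obtain r0 t where rt: "r0 \<in> S" "t \<in> T - S" using assms by blast
  have "walk_in T r0 t" using assms rt by (auto simp: connected_set_def)
  then have "t \<notin> S \<longrightarrow> (\<exists>w r. w \<in> T - S \<and> r \<in> S \<and> adj w r)"
    unfolding walk_in_def
  proof (induction rule: rtranclp_induct)
    case (step y z)
    then show ?case using adj_sym by blast
  qed (use rt in auto)
  then show thesis using rt that by blast
qed

text \<open>The only way to leave a component of the tree without \<open>v\<close> is through \<open>v\<close>.\<close>

lemma branch_has_neighbour: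
  assumes "v \<in> V" "u \<in> V - {v}"
  obtains c where "c \<in> branch v u" "adj v c"
proof -
  have "branch v u \<noteq> {}" "branch v u \<noteq> V" "branch v u \<subseteq> V"
    using component_self[OF assms(2)] component_subset[of "V - {v}" u] assms by auto
  then obtain w r where "w \<in> V - branch v u" "r \<in> branch v u" "adj w r"
    using boundary[OF connected_V] by metis
  moreover from this have "w = v" using component_step[of r "V - {v}" u w] adj_sym by auto
  ultimately show thesis using that by blast
qed

lemma branch_nested:
  assumes "v \<in> V" "z \<in> V - {v}" "u \<noteq> v" "u \<notin> branch v z"
  shows "insert v (branch v z) \<subseteq> branch u v"
proof -
  obtain c where "c \<in> branch v z" "adj v c" using branch_has_neighbour assms by blast
  then have "connected_set (insert v (branch v z))"
    using connected_set_insert connected_set_component adj_sym by blast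
  moreover have "insert v (branch v z) \<subseteq> V - {u}"
    using assms component_subset[of "V - {v}" z] by auto
  ultimately show ?thesis using connected_subset_component by blast
qed

lemma component_two_adjacent:
  assumes "adj u w" "z \<in> branch u w" "z \<noteq> w"
  shows "\<exists>c \<in> component (V - {u,w}) z. adj w c"
proof -
  let ?C = "component (V - {u,w}) z"
  have z: "z \<in> V - {u,w}" using assms component_subset[of "V - {u}" w] by auto
  have wu: "w \<in> V - {u}" using assms adj_irrefl adj_in_V2 by auto
  have "?C \<subseteq> branch u z"
    by (rule connected_subset_component[OF connected_set_component])
      (use component_self[OF z] component_subset[of "V - {u,w}" z] in auto)
  then have sub: "?C \<subseteq> branch u w" using component_eq[OF assms(2)] by simp
  moreover have "?C \<noteq> {}" "?C \<noteq> branch u w"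
    using component_self[OF z] component_self[OF wu] component_subset[of "V - {u,w}" z] by auto
  ultimately obtain x c where xc: "x \<in> branch u w - ?C" "c \<in> ?C" "adj x c"
    using boundary[OF connected_set_component] by metis
  have "x \<in> V - {u}" using xc component_subset[of "V - {u}" w] by auto
  then have "x = w" using component_step[of c "V - {u,w}" z x] xc adj_sym by auto
  then show ?thesis using xc by auto
qed

text \<open>A vertex reached from both sides of the edge \<open>uw\<close> without using it would join the two ends
  a second time: its component \<open>C\<close> in the absence of \<open>u\<close> and \<open>w\<close> touches both, so \<open>u\<close> would be
  attached twice to the connected set \<open>C \<union> {w}\<close>.\<close>

lemma branches_across_edge_disjoint:
  assumes "adj u w"
  shows "branch u w \<inter> branch w u = {}"
proof (rule ccontr)
  assume "branch u w \<inter> branch w u \<noteq> {}"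
  then obtain z where z: "z \<in> branch u w" "z \<in> branch w u" by auto
  have zw: "z \<noteq> w" "z \<noteq> u" using z component_subset[of "V - {u}" w] component_subset[of "V - {w}" u] by auto
  let ?C = "component (V - {u,w}) z"
  obtain c where c: "c \<in> ?C" "adj w c" using component_two_adjacent assms z zw by blast
  obtain c' where c': "c' \<in> ?C" "adj u c'"
    using component_two_adjacent[OF adj_sym[OF assms] z(2) zw(2)] by (auto simp: insert_commute)
  have C: "?C \<subseteq> V - {u,w}" by (rule component_subset)
  have "connected_set (insert w ?C)"
    using connected_set_insert[OF connected_set_component c(1)] c(2) adj_sym by blast
  moreover have "insert w ?C \<subseteq> V" "u \<notin> insert w ?C" using C assms adj_irrefl adj_in_V2 by auto
  ultimately have "c' = w" using attach[of "insert w ?C" u c' w] c' assms by auto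
  then show False using c' C by auto
qed

lemma branch_of_adjacent:
  assumes "adj u v" "u \<noteq> x" "v \<noteq> x"
  shows "branch x u = branch x v"
proof -
  have "v \<in> branch x u"
    by (rule component_step[OF component_self]) (use assms adj_in_V adj_in_V2 in auto)
  then show ?thesis using component_eq by blast
qed

text \<open>The component of \<open>x\<close> in the absence of \<open>u\<close> and \<open>v\<close> must border on one of the two.\<close>

lemma edge_separates:
  assumes "adj u v" "x \<in> V - {u,v}"
  shows "x \<in> branch u v \<or> x \<in> branch v u"
proof -
  let ?C = "component (V - {u,v}) x"
  have C: "?C \<subseteq> V - {u,v}" "x \<in> ?C"
    by (rule component_subset, rule component_self[OF assms(2)])
  have uv: "u \<in> V" "v \<in> V" "u \<noteq> v" using assms adj_irrefl adj_in_V adj_in_V2 by auto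
  have "?C \<subseteq> V" "?C \<noteq> {}" "?C \<noteq> V" using C uv by auto
  then obtain w r where wr: "w \<in> V - ?C" "r \<in> ?C" "adj w r"
    using boundary[OF connected_V] by metis
  have con: "connected_set (insert w ?C)"
    using connected_set_insert[OF connected_set_component wr(2)] wr(3) adj_sym by blast
  have "w = u \<or> w = v" using component_step[of r "V - {u,v}" x w] wr adj_sym by auto
  then show ?thesis
  proof
    assume "w = v"
    then have "insert w ?C \<subseteq> branch u v"
      using connected_subset_component[OF con, of "V - {u}" v] C uv by auto
    then show ?thesis using C by auto
  next
    assume "w = u"
    then have "insert w ?C \<subseteq> branch v u"
      using connected_subset_component[OF con, of "V - {v}" u] C uv by auto
    then show ?thesis using C by auto
  qed
qed

lemma neighbours_in_branch_eq:
  assumes "adj v c" "adj v c'" "branch v c = branch v c'"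
  shows "c = c'"
proof -
  have "c \<in> V - {v}" "c' \<in> V - {v}" using assms adj_irrefl adj_in_V2 by auto
  then have "c \<in> branch v c" "c' \<in> branch v c" using assms component_self by auto
  moreover have "branch v c \<subseteq> V" "v \<notin> branch v c" using component_subset[of "V - {v}" c] by auto
  ultimately show ?thesis using attach[OF connected_set_component] assms by blast
qed

lemma branches_at_eqI:
  assumes "B \<in> branches_at v" "x \<in> B"
  shows "B = branch v x"
  using assms component_eq by (auto simp: branches_at_def)

lemma branches_at_props:
  assumes "B \<in> branches_at v"
  shows "connected_set B" "B \<noteq> {}" "B \<subseteq> V - {v}"
proof -
  obtain u where u: "u \<in> V - {v}" "B = branch v u" using assms by (auto simp: branches_at_def)
  show "connected_set B" "B \<noteq> {}" "B \<subseteq> V - {v}"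
    using u component_self[OF u(1)] component_subset[of "V - {v}" u]
    by (auto simp: connected_set_component)
qed

end

section \<open>Perron branches for a strictly monotone branch value\<close>

text \<open>The spectral radius of the bottleneck matrix enters the combinatorics only through strict
  monotonicity along connected sets.\<close>

locale valued_tree = abstract_tree +
  fixes r :: "'a set \<Rightarrow> real"
  assumes two_vertices: "2 \<le> card V"
    and r_strict_mono: "\<lbrakk>connected_set S; connected_set T; S \<noteq> {}; S \<subset> T; T \<subset> V\<rbrakk> \<Longrightarrow> r S < r T"
begin

definition perron_at :: "'a \<Rightarrow> 'a set set" where
  "perron_at v = {B \<in> branches_at v. \<forall>B' \<in> branches_at v. r B' \<le> r B}"

definition multi_perron_at :: "'a \<Rightarrow> bool" where
  "multi_perron_at v \<longleftrightarrow> v \<in> V \<and> 2 \<le> card (perron_at v)"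

definition facing :: "'a \<Rightarrow> 'a \<Rightarrow> bool" where
  "facing u v \<longleftrightarrow> adj u v \<and> perron_at u = {branch u v} \<and> perron_at v = {branch v u}"

definition characteristic_set :: "'a set" where
  "characteristic_set = {v. multi_perron_at v \<and> (\<forall>w. multi_perron_at w \<longrightarrow> w = v)} \<union>
     {u. \<exists>v. facing u v \<and> (\<forall>u' v'. facing u' v' \<longrightarrow> {u', v'} = {u, v})}"

lemma finite_branches_at: "finite (branches_at v)"
  by (simp add: branches_at_def finite_V)

lemma branch_in: "u \<in> V - {v} \<Longrightarrow> branch v u \<in> branches_at v"
  by (simp add: branches_at_def)

lemma other_vertex: obtains u where "u \<in> V" "u \<noteq> v"
proof -
  have "\<not> V \<subseteq> {v}" using two_vertices card_mono[of "{v}" V] by auto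
  then show thesis using that by auto
qed

lemma perron_nonempty: "perron_at v \<noteq> {}"
proof -
  obtain u where "u \<in> V" "u \<noteq> v" by (rule other_vertex)
  then have ne: "branches_at v \<noteq> {}" by (auto simp: branches_at_def)
  define M where "M = Max (r ` branches_at v)"
  have "M \<in> r ` branches_at v" unfolding M_def using ne finite_branches_at by (intro Max_in) auto
  then obtain B where "B \<in> branches_at v" "r B = M" by auto
  moreover have "r B' \<le> M" if "B' \<in> branches_at v" for B'
    unfolding M_def using that finite_branches_at by auto
  ultimately show ?thesis by (auto simp: perron_at_def)
qed

text \<open>Removing a vertex \<open>u\<close> outside \<open>B\<close> leaves \<open>B\<close> attached to \<open>v\<close>; the vertex \<open>v\<close> itself makes the
  resulting inclusion proper, and hence the comparison strict.\<close>

lemma branch_value_less: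
  assumes "v \<in> V" "u \<in> V" "B \<in> branches_at v" "u \<noteq> v" "u \<notin> B"
  shows "r B < r (branch u v)"
proof (rule r_strict_mono)
  obtain z where z: "z \<in> V - {v}" "B = branch v z" using assms by (auto simp: branches_at_def)
  have "insert v B \<subseteq> branch u v" using branch_nested z assms by auto
  moreover have "v \<notin> B" using branches_at_props(3)[OF assms(3)] by auto
  ultimately show "B \<subset> branch u v" by auto
  show "branch u v \<subset> V" using component_subset[of "V - {u}" v] assms by auto
qed (use assms branches_at_props connected_set_component in auto)

text \<open>Every branch at \<open>x\<close> in another direction lies properly in the branch at \<open>v\<close> containing \<open>x\<close>, so
  its value is below that of the Perron branch \<open>B\<close>; and \<open>B\<close> lies properly in the branch at \<open>x\<close> towards
  \<open>v\<close>.\<close>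

lemma perron_towards:
  assumes v: "v \<in> V" and x: "x \<in> V" "x \<noteq> v" and B: "B \<in> perron_at v" "x \<notin> B"
  shows "perron_at x = {branch x v}"
proof -
  have Bb: "B \<in> branches_at v" using B by (simp add: perron_at_def)
  have "r C < r (branch x v)" if C: "C \<in> branches_at x" "C \<noteq> branch x v" for C
  proof -
    have "v \<notin> C" using branches_at_eqI C by blast
    then have "r C < r (branch v x)" using branch_value_less[of x v C] C x v by auto
    also have "\<dots> \<le> r B" using B branch_in[of x v] x by (auto simp: perron_at_def)
    also have "\<dots> < r (branch x v)" using branch_value_less[of v x B] Bb v x B by auto
    finally show ?thesis .
  qed
  note less = this
  have in_branches: "branch x v \<in> branches_at x" using branch_in v x by auto
  show ?thesis
  proof
    show "perron_at x \<subseteq> {branch x v}"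
      using less in_branches by (auto simp: perron_at_def not_le[symmetric])
    show "{branch x v} \<subseteq> perron_at x"
      using less in_branches by (auto simp: perron_at_def intro: less_imp_le)
  qed
qed

lemma facing_sym: "facing u v \<Longrightarrow> facing v u"
  using adj_sym by (auto simp: facing_def)

text \<open>If every vertex has a single Perron branch, walking from a vertex into its Perron branch must turn
  back somewhere. It does so at a vertex whose Perron branch has the fewest vertices: a
  neighbour that pointed further on would have a smaller Perron branch still.\<close>

lemma facing_exists:
  assumes unique: "\<And>v. v \<in> V \<Longrightarrow> card (perron_at v) < 2"
  shows "\<exists>u v. facing u v"
proof -
  have single: "\<exists>B. perron_at v = {B}" if "v \<in> V" for v
  proof -
    have "finite (perron_at v)" using finite_branches_at by (auto simp: perron_at_def)
    then have "card (perron_at v) = 1" using unique[OF that] perron_nonempty[of v] 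
      by (metis card_gt_0_iff less_2_cases less_nat_zero_code One_nat_def)
    then show ?thesis by (simp add: card_1_singleton_iff)
  qed
  define P where "P v = (THE B. perron_at v = {B})" for v
  have P: "perron_at v = {P v}" if "v \<in> V" for v
    using single[OF that] by (auto simp: P_def)
  obtain v0 where v0: "v0 \<in> V" by (rule other_vertex)
  \<comment> \<open>the turning point of the walk\<close>
  obtain v where v: "v \<in> V" and min: "\<And>u. u \<in> V \<Longrightarrow> card (P v) \<le> card (P u)"
    using ex_has_least_nat[of "\<lambda>v. v \<in> V" v0 "\<lambda>v. card (P v)"] v0 by auto
  have Pb: "P u \<in> branches_at u" if "u \<in> V" for u using P[OF that] by (auto simp: perron_at_def)
  obtain z where z: "z \<in> V - {v}" "P v = branch v z" using Pb[OF v] by (auto simp: branches_at_def)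
  obtain u where u: "u \<in> P v" "adj v u" using branch_has_neighbour[OF v z(1)] z(2) by auto
  have uV: "u \<in> V" "u \<noteq> v" using u adj_in_V2 adj_irrefl by auto
  have Pv: "P v = branch v u" using branches_at_eqI[OF Pb[OF v] u(1)] .
  have "P u = branch u v"
  proof (rule ccontr)
    assume "P u \<noteq> branch u v"
    then have "v \<notin> P u" using branches_at_eqI Pb[OF uV(1)] by blast
    moreover obtain y where "y \<in> V - {u}" "P u = branch u y"
      using Pb[OF uV(1)] by (auto simp: branches_at_def)
    ultimately have "insert u (P u) \<subseteq> P v" using branch_nested[of u y v] uV Pv by auto
    moreover have "u \<notin> P u" using branches_at_props(3)[OF Pb[OF uV(1)]] by auto
    ultimately have "P u \<subset> P v" by auto
    moreover have "finite (P v)" using branches_at_props(3)[OF Pb[OF v]] finite_V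
      by (meson finite_Diff finite_subset)
    ultimately have "card (P u) < card (P v)" by (simp add: psubset_card_mono)
    then show False using min[OF uV(1)] by simp
  qed
  then have "facing v u" using P[OF v] P[OF uV(1)] Pv u by (simp add: facing_def)
  then show ?thesis by blast
qed

lemma perron_outside_multi:
  assumes "multi_perron_at v" "x \<in> V" "x \<noteq> v"
  shows "perron_at x = {branch x v}"
proof -
  have "v \<in> V" "2 \<le> card (perron_at v)" using assms by (auto simp: multi_perron_at_def)
  then have "\<not> perron_at v \<subseteq> {branch v x}" using card_mono[of "{branch v x}" "perron_at v"] by auto
  then obtain B where B: "B \<in> perron_at v" "B \<noteq> branch v x" by auto
  then have "x \<notin> B" using branches_at_eqI[of B v x] by (auto simp: perron_at_def)
  then show ?thesis using perron_towards[of v x B] B \<open>v \<in> V\<close> assms by auto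
qed

lemma multi_unique: "multi_perron_at v \<Longrightarrow> multi_perron_at w \<Longrightarrow> w = v"
  using perron_outside_multi[of v w] by (cases "w = v") (auto simp: multi_perron_at_def)

text \<open>The two ends of a facing edge would both have to point towards \<open>v\<close>, which lies on only one
  side of that edge.\<close>

lemma not_facing_multi:
  assumes "multi_perron_at v"
  shows "\<not> facing u w"
proof
  assume f: "facing u w"
  have "u \<noteq> v" "w \<noteq> v" using f assms by (auto simp: facing_def multi_perron_at_def)
  moreover have uw: "adj u w" "u \<in> V" "w \<in> V" using f adj_in_V adj_in_V2 by (auto simp: facing_def)
  ultimately have "branch u v = branch u w" "branch w v = branch w u"
    using perron_outside_multi[OF assms] f by (auto simp: facing_def)
  moreover have "v \<in> V" using assms by (simp add: multi_perron_at_def)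
  ultimately have "v \<in> branch u w" "v \<in> branch w u"
    using component_self[of v "V - {u}"] component_self[of v "V - {w}"] \<open>u \<noteq> v\<close> \<open>w \<noteq> v\<close> by auto
  then show False using branches_across_edge_disjoint[OF uw(1)] by auto
qed

lemma perron_outside_facing:
  assumes f: "facing u v" and x: "x \<in> V - {u, v}"
  shows "perron_at x = {branch x u}" "u \<in> branch x u" "v \<in> branch x u"
proof -
  have uv: "adj u v" "u \<in> V" "v \<in> V" using f adj_in_V adj_in_V2 by (auto simp: facing_def)
  have eq: "branch x u = branch x v" by (rule branch_of_adjacent) (use uv x in auto)
  show "u \<in> branch x u" by (rule component_self) (use uv x in auto)
  show "v \<in> branch x u" unfolding eq by (rule component_self) (use uv x in auto)
  have dis: "branch u v \<inter> branch v u = {}" by (rule branches_across_edge_disjoint[OF uv(1)])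
  from edge_separates[OF uv(1) x] show "perron_at x = {branch x u}"
  proof
    assume "x \<in> branch u v"
    then have "x \<notin> branch v u" using dis by auto
    moreover have "branch v u \<in> perron_at v" using f by (simp add: facing_def)
    ultimately show ?thesis using perron_towards[of v x "branch v u"] uv x unfolding eq by simp
  next
    assume "x \<in> branch v u"
    then have "x \<notin> branch u v" using dis by auto
    moreover have "branch u v \<in> perron_at u" using f by (simp add: facing_def)
    ultimately show ?thesis using perron_towards[of u x "branch u v"] uv x by simp
  qed
qed

text \<open>Off the first facing edge every vertex points towards that edge, so a second facing edge
  would need one end pointing away from it.\<close>

lemma facing_endpoint:
  assumes f: "facing u v" and g: "facing a b"
  shows "a = u \<or> a = v"
proof (rule ccontr)
  assume n: "\<not> ?thesis"
  have ab: "adj a b" "a \<in> V" "b \<in> V" using g adj_in_V adj_in_V2 by (auto simp: facing_def)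
  have uv: "adj u v" using f by (simp add: facing_def)
  have a: "perron_at a = {branch a u}" "u \<in> branch a u" "v \<in> branch a u"
    using perron_outside_facing[OF f, of a] n ab by auto
  have ba: "branch a u = branch a b" using a(1) g by (auto simp: facing_def)
  have bb: "perron_at b = {branch b a}" using g by (simp add: facing_def)
  consider "b = u" | "b = v" | "b \<in> V - {u, v}" using ab by auto
  then show False
  proof cases
    case 1
    then have "branch u v = branch u a" using f bb by (auto simp: facing_def)
    then have "a = v" using neighbours_in_branch_eq[of u a v] 1 ab uv adj_sym by auto
    then show False using n by simp
  next
    case 2
    then have "branch v u = branch v a" using f bb by (auto simp: facing_def)
    then have "a = u" using neighbours_in_branch_eq[of v a u] 2 ab uv adj_sym by auto
    then show False using n by simp
  next
    case 3
    have "branch b u = branch b a" "u \<in> branch b u"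
      using perron_outside_facing[OF f 3] bb by auto
    then show False using a(2) ba branches_across_edge_disjoint[OF ab(1)] by auto
  qed
qed

lemma facing_unique:
  assumes f: "facing u v" and g: "facing a b"
  shows "{a, b} = {u, v}"
proof -
  have "a \<noteq> b" using g adj_irrefl by (auto simp: facing_def)
  then show ?thesis using facing_endpoint[OF f g] facing_endpoint[OF f facing_sym[OF g]] by auto
qed

theorem perron_outside_characteristic_set:
  assumes x: "x \<in> V" "x \<notin> characteristic_set"
  shows "\<exists>B. perron_at x = {B} \<and> characteristic_set \<noteq> {} \<and> characteristic_set \<subseteq> B"
proof (cases "\<exists>v. multi_perron_at v")
  case True
  then obtain v where v: "multi_perron_at v" by auto
  have ch: "characteristic_set = {v}"
    using v by (auto simp: characteristic_set_def not_facing_multi[OF v] dest: multi_unique[OF v])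
  then have "perron_at x = {branch x v}" using perron_outside_multi[OF v] x by auto
  moreover have "v \<in> branch x v" using component_self[of v "V - {x}"] v x ch by (auto simp: multi_perron_at_def)
  ultimately show ?thesis using ch by auto
next
  case False
  then have "card (perron_at v) < 2" if "v \<in> V" for v
    using that by (auto simp: multi_perron_at_def not_le)
  then obtain u v where f: "facing u v" using facing_exists by blast
  have ch: "characteristic_set = {u, v}"
  proof
    show "characteristic_set \<subseteq> {u, v}"
      using False by (auto simp: characteristic_set_def dest: facing_endpoint[OF f])
    have "u \<in> characteristic_set"
      unfolding characteristic_set_def
      by (intro UnI2 CollectI exI[of _ v] conjI allI impI f facing_unique[OF f])
    moreover have "v \<in> characteristic_set"
      unfolding characteristic_set_def
      by (intro UnI2 CollectI exI[of _ u] conjI allI impI facing_sym[OF f]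
          facing_unique[OF facing_sym[OF f]])
    ultimately show "{u, v} \<subseteq> characteristic_set" by simp
  qed
  then have "x \<in> V - {u, v}" using x by auto
  from perron_outside_facing[OF f this] show ?thesis using ch by auto
qed

end

section \<open>Least eigenvalues of real symmetric kernels\<close>

text \<open>Indexing by arbitrary finite sets lets block matrices be indexed by pairs of a vertex and an
  inner index, and principal blocks be taken by shrinking the set. Only the values of the vector
  \<open>\<phi>\<close> on \<open>I\<close> matter.\<close>

definition eigenvalue_on :: "'i set \<Rightarrow> ('i \<Rightarrow> 'i \<Rightarrow> 'a::comm_ring_1) \<Rightarrow> 'a \<Rightarrow> bool" where
  "eigenvalue_on I a \<mu> \<longleftrightarrow>
     (\<exists>\<phi>. (\<exists>p\<in>I. \<phi> p \<noteq> 0) \<and> (\<forall>p\<in>I. (\<Sum>q\<in>I. a p q * \<phi> q) = \<mu> * \<phi> p))"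

definition quadratic :: "'i set \<Rightarrow> ('i \<Rightarrow> 'i \<Rightarrow> real) \<Rightarrow> ('i \<Rightarrow> real) \<Rightarrow> real" where
  "quadratic I a \<phi> = (\<Sum>p\<in>I. \<Sum>q\<in>I. \<phi> p * a p q * \<phi> q)"

text \<open>The last clause makes \<open>m\<close> the minimum of the Rayleigh quotient, so that the least eigenvalue
  comes together with an eigenvector.\<close>

definition ground_state :: "'i set \<Rightarrow> ('i \<Rightarrow> 'i \<Rightarrow> real) \<Rightarrow> real \<Rightarrow> ('i \<Rightarrow> real) \<Rightarrow> bool" where
  "ground_state I a m z \<longleftrightarrow> (\<exists>p\<in>I. z p \<noteq> 0) \<and> (\<forall>p\<in>I. (\<Sum>q\<in>I. a p q * z q) = m * z p) \<and>
     (\<forall>\<phi>. m * (\<Sum>p\<in>I. (\<phi> p)\<^sup>2) \<le> quadratic I a \<phi>)"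

lemma linear_coeff_zero:
  fixes b c :: real
  assumes "\<And>t. 0 \<le> t * b + t\<^sup>2 * c"
  shows "b = 0"
proof (rule ccontr)
  assume b: "b \<noteq> 0"
  define k where "k = \<bar>c\<bar> + 1"
  have k: "k > 0" "c < k" by (auto simp: k_def)
  \<comment> \<open>\<open>k > c\<close> makes the linear term win at \<open>t = - b / k\<close>\<close>
  have "(- b / k) * b + (- b / k)\<^sup>2 * c = (b / k)\<^sup>2 * (c - k)"
    using k by (simp add: field_simps power2_eq_square)
  moreover have "(b / k)\<^sup>2 * (c - k) < 0" using b k by (intro mult_pos_neg) auto
  ultimately show False using assms[of "- b / k"] by simp
qed

lemma quadratic_perturb:
  assumes "finite I" "\<And>p q. p \<in> I \<Longrightarrow> q \<in> I \<Longrightarrow> a p q = a q p" "p0 \<in> I"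
  shows "quadratic I a (\<lambda>p. z p + (if p = p0 then t else 0)) =
    quadratic I a z + t * (2 * (\<Sum>q\<in>I. a p0 q * z q)) + t\<^sup>2 * a p0 p0"
proof -
  let ?d = "\<lambda>p. if p = p0 then t else 0"
  have "quadratic I a (\<lambda>p. z p + ?d p) =
     (\<Sum>p\<in>I. \<Sum>q\<in>I. z p * a p q * z q) + (\<Sum>p\<in>I. \<Sum>q\<in>I. z p * a p q * ?d q)
     + (\<Sum>p\<in>I. \<Sum>q\<in>I. ?d p * a p q * z q) + (\<Sum>p\<in>I. \<Sum>q\<in>I. ?d p * a p q * ?d q)"
    unfolding quadratic_def by (simp add: algebra_simps sum.distrib)
  also have "(\<Sum>p\<in>I. \<Sum>q\<in>I. z p * a p q * ?d q) = (\<Sum>p\<in>I. z p * a p p0 * t)"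
    using assms by (intro sum.cong refl) (simp add: if_distrib cong: if_cong)
  also have "\<dots> = t * (\<Sum>q\<in>I. a p0 q * z q)"
    using assms by (auto simp: sum_distrib_left intro!: sum.cong)
  also have "(\<Sum>p\<in>I. \<Sum>q\<in>I. ?d p * a p q * z q) = (\<Sum>p\<in>I. if p = p0 then t * (\<Sum>q\<in>I. a p0 q * z q) else 0)"
    by (intro sum.cong refl) (simp add: sum_distrib_left mult.assoc)
  also have "\<dots> = t * (\<Sum>q\<in>I. a p0 q * z q)" using assms by simp
  also have "(\<Sum>p\<in>I. \<Sum>q\<in>I. ?d p * a p q * ?d q) = (\<Sum>p\<in>I. if p = p0 then t * a p0 p0 * t else 0)"
    using assms by (intro sum.cong refl) (simp add: if_distrib cong: if_cong)
  also have "\<dots> = t\<^sup>2 * a p0 p0" using assms by (simp add: power2_eq_square)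
  finally show ?thesis by (simp add: quadratic_def)
qed

lemma norm_perturb:
  assumes "finite I" "p0 \<in> I"
  shows "(\<Sum>p\<in>I. (z p + (if p = p0 then t else 0))\<^sup>2) = (\<Sum>p\<in>I. (z p)\<^sup>2) + t * (2 * z p0) + (t\<^sup>2 :: real)"
proof -
  have "(\<Sum>p\<in>I. (z p + (if p = p0 then t else 0))\<^sup>2) =
     (\<Sum>p\<in>I. (z p)\<^sup>2 + (if p = p0 then t * (2 * z p0) + t\<^sup>2 else 0))"
    by (intro sum.cong refl) (simp add: power2_eq_square algebra_simps)
  then show ?thesis using assms by (simp add: sum.distrib)
qed

text \<open>First variation: moving one coordinate of a minimiser by \<open>t\<close> changes the difference of the two
  sides of the bound by a quadratic polynomial in \<open>t\<close> that is nonnegative and vanishes at 0, so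
  its linear coefficient is 0.\<close>

lemma minimiser_is_eigenvector:
  assumes "finite I" "\<And>p q. p \<in> I \<Longrightarrow> q \<in> I \<Longrightarrow> a p q = a q p"
    and bound: "\<And>\<phi>. m * (\<Sum>p\<in>I. (\<phi> p)\<^sup>2) \<le> quadratic I a \<phi>"
    and eq: "quadratic I a z = m * (\<Sum>p\<in>I. (z p)\<^sup>2)"
    and p: "p \<in> I"
  shows "(\<Sum>q\<in>I. a p q * z q) = m * z p"
proof -
  have "0 \<le> t * (2 * (\<Sum>q\<in>I. a p q * z q) - m * (2 * z p)) + t\<^sup>2 * (a p p - m)" for t
    using bound[of "\<lambda>q. z q + (if q = p then t else 0)"]
      quadratic_perturb[of I a p z t, OF assms(1,2) p] norm_perturb[OF assms(1) p, of z t] eq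
    by (simp add: algebra_simps)
  then have "2 * (\<Sum>q\<in>I. a p q * z q) - m * (2 * z p) = 0" by (rule linear_coeff_zero)
  then show ?thesis by simp
qed

lemma quadratic_eigenvector:
  assumes "\<And>p. p \<in> I \<Longrightarrow> (\<Sum>q\<in>I. a p q * z q) = m * z p"
  shows "quadratic I a z = m * (\<Sum>p\<in>I. (z p)\<^sup>2)"
proof -
  have "quadratic I a z = (\<Sum>p\<in>I. z p * (\<Sum>q\<in>I. a p q * z q))"
    by (simp add: quadratic_def sum_distrib_left mult.assoc)
  also have "\<dots> = (\<Sum>p\<in>I. m * (z p)\<^sup>2)"
    by (intro sum.cong refl) (simp add: assms power2_eq_square)
  finally show ?thesis by (simp add: sum_distrib_left)
qed

lemma quadratic_scale: "quadratic I a (\<lambda>p. c * z p) = c\<^sup>2 * quadratic I a z"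
  by (simp add: quadratic_def sum_distrib_left power2_eq_square mult_ac)

lemma quadratic_cong: "(\<And>p. p \<in> I \<Longrightarrow> \<phi> p = \<psi> p) \<Longrightarrow> quadratic I a \<phi> = quadratic I a \<psi>"
  by (simp add: quadratic_def cong: sum.cong)

text \<open>The quadratic form attains its minimum on the unit sphere of the vectors supported in \<open>I\<close>,
  which is a closed subset of a cube in the product topology.\<close>

lemma ground_state_exists:
  assumes fin: "finite I" and ne: "I \<noteq> {}"
    and sym: "\<And>p q. p \<in> I \<Longrightarrow> q \<in> I \<Longrightarrow> a p q = a q p"
  shows "\<exists>m z. ground_state I a m z"
proof -
  define K where "K = {\<phi> :: 'a \<Rightarrow> real. (\<forall>p. p \<notin> I \<longrightarrow> \<phi> p = 0) \<and> (\<Sum>p\<in>I. (\<phi> p)\<^sup>2) = 1}"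
  have cont: "continuous_on A (\<lambda>\<phi> :: 'a \<Rightarrow> real. \<phi> p)" for A p
    by (rule continuous_on_subset[OF continuous_on_product_coordinates]) auto
  have "compactin (product_topology (\<lambda>_::'a. euclidean) UNIV) (PiE UNIV (\<lambda>_. {-1..1::real}))"
    by (simp add: compactin_PiE compactin_euclidean_iff)
  then have cube: "compact (PiE UNIV (\<lambda>_::'a. {-1..1::real}))"
    by (simp add: euclidean_product_topology compactin_euclidean_iff)
  have closed: "closed K"
  proof -
    have "K = (\<Inter>p\<in>-I. {\<phi>. \<phi> p = 0}) \<inter> {\<phi>. (\<Sum>p\<in>I. (\<phi> p)\<^sup>2) = 1}" by (auto simp: K_def)
    moreover have "closed {\<phi> :: 'a \<Rightarrow> real. \<phi> p = 0}" for p
      by (intro closed_Collect_eq cont continuous_on_const)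
    moreover have "closed {\<phi> :: 'a \<Rightarrow> real. (\<Sum>p\<in>I. (\<phi> p)\<^sup>2) = 1}"
      by (intro closed_Collect_eq continuous_intros cont)
    ultimately show ?thesis by auto
  qed
  have "K \<subseteq> PiE UNIV (\<lambda>_. {-1..1})"
  proof
    fix \<phi> assume \<phi>: "\<phi> \<in> K"
    have "\<bar>\<phi> p\<bar> \<le> 1" for p
    proof (cases "p \<in> I")
      case True
      then have "(\<phi> p)\<^sup>2 \<le> (\<Sum>p\<in>I. (\<phi> p)\<^sup>2)" using fin by (intro member_le_sum) auto
      then show ?thesis using \<phi> by (simp add: K_def abs_square_le_1)
    qed (use \<phi> in \<open>simp add: K_def\<close>)
    then show "\<phi> \<in> PiE UNIV (\<lambda>_. {-1..1})" by (auto simp: abs_le_iff minus_le_iff)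
  qed
  then have "compact K" using cube closed compact_Int_closed[of _ K] by (metis inf.absorb_iff2)
  moreover have "K \<noteq> {}"
  proof -
    obtain p0 where p0: "p0 \<in> I" using ne by auto
    have "(\<Sum>p\<in>I. (if p = p0 then 1 else 0 :: real)\<^sup>2) = (\<Sum>p\<in>I. if p = p0 then 1 else 0)"
      by (intro sum.cong) auto
    then have "(\<lambda>p. if p = p0 then 1 else 0) \<in> K" using p0 fin by (auto simp: K_def)
    then show ?thesis by auto
  qed
  moreover have "continuous_on K (quadratic I a)"
    unfolding quadratic_def by (intro continuous_intros cont)
  ultimately obtain z where z: "z \<in> K" "\<And>\<phi>. \<phi> \<in> K \<Longrightarrow> quadratic I a z \<le> quadratic I a \<phi>"
    using continuous_attains_inf by metis
  define m where "m = quadratic I a z"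
  have bound: "m * (\<Sum>p\<in>I. (\<phi> p)\<^sup>2) \<le> quadratic I a \<phi>" for \<phi>
  proof (cases "(\<Sum>p\<in>I. (\<phi> p)\<^sup>2) = 0")
    case True
    then have "\<And>p. p \<in> I \<Longrightarrow> \<phi> p = 0" using fin by (simp add: sum_nonneg_eq_0_iff)
    then have "quadratic I a \<phi> = 0" by (simp add: quadratic_def)
    then show ?thesis using True by simp
  next
    case False
    define N where "N = (\<Sum>p\<in>I. (\<phi> p)\<^sup>2)"
    have N: "N > 0" using False by (auto simp: N_def less_le intro: sum_nonneg)
    define \<psi> where "\<psi> p = (if p \<in> I then \<phi> p / sqrt N else 0)" for p
    have "(\<Sum>p\<in>I. (\<psi> p)\<^sup>2) = (\<Sum>p\<in>I. (\<phi> p)\<^sup>2 / N)"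
      using N by (intro sum.cong) (auto simp: \<psi>_def power_divide)
    also have "\<dots> = 1" using N by (simp add: sum_divide_distrib[symmetric] N_def)
    finally have "\<psi> \<in> K" by (simp add: K_def \<psi>_def)
    then have "m \<le> quadratic I a \<psi>" using z m_def by simp
    also have "quadratic I a \<psi> = quadratic I a (\<lambda>p. (1 / sqrt N) * \<phi> p)"
      by (rule quadratic_cong) (simp add: \<psi>_def)
    also have "\<dots> = quadratic I a \<phi> / N"
      unfolding quadratic_scale using N by (simp add: power_divide)
    finally show ?thesis using N by (simp add: field_simps N_def[symmetric])
  qed
  have "quadratic I a z = m * (\<Sum>p\<in>I. (z p)\<^sup>2)" using z by (simp add: K_def m_def)
  then have "\<And>p. p \<in> I \<Longrightarrow> (\<Sum>q\<in>I. a p q * z q) = m * z p"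
    using minimiser_is_eigenvector[OF fin sym bound] by blast
  moreover have "\<exists>p\<in>I. z p \<noteq> 0"
  proof (rule ccontr)
    assume "\<not> ?thesis"
    then have "(\<Sum>p\<in>I. (z p)\<^sup>2) = 0" by simp
    then show False using z by (simp add: K_def)
  qed
  ultimately have "ground_state I a m z" using bound by (simp add: ground_state_def)
  then show ?thesis by blast
qed

lemma sum_squares_pos:
  fixes z :: "'i \<Rightarrow> real"
  assumes "finite I" "p \<in> I" "z p \<noteq> 0"
  shows "0 < (\<Sum>p\<in>I. (z p)\<^sup>2)"
  using assms by (intro sum_pos2[of I p]) auto

text \<open>The real and the imaginary part of a complex eigenvector are tested separately against the
  Rayleigh bound; the contributions of the imaginary part of \<open>\<mu>\<close> cancel in the sum.\<close>

lemma ground_state_least: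
  assumes fin: "finite I" and g: "ground_state I a m z"
    and e: "eigenvalue_on I (\<lambda>p q. complex_of_real (a p q)) \<mu>"
  shows "m \<le> Re \<mu>"
proof -
  obtain \<phi> p0 where p0: "p0 \<in> I" "\<phi> p0 \<noteq> 0"
    and \<phi>: "\<And>p. p \<in> I \<Longrightarrow> (\<Sum>q\<in>I. complex_of_real (a p q) * \<phi> q) = \<mu> * \<phi> p"
    using e by (auto simp: eigenvalue_on_def)
  let ?x = "\<lambda>p. Re (\<phi> p)" and ?y = "\<lambda>p. Im (\<phi> p)"
  define N where "N = (\<Sum>p\<in>I. (?x p)\<^sup>2) + (\<Sum>p\<in>I. (?y p)\<^sup>2)"
  have "?x p0 \<noteq> 0 \<or> ?y p0 \<noteq> 0" using p0 by (simp add: complex_eq_iff)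
  then have "0 < (\<Sum>p\<in>I. (?x p)\<^sup>2) \<or> 0 < (\<Sum>p\<in>I. (?y p)\<^sup>2)"
    using sum_squares_pos[OF fin p0(1), of ?x] sum_squares_pos[OF fin p0(1), of ?y] by blast
  moreover have "0 \<le> (\<Sum>p\<in>I. (?x p)\<^sup>2)" "0 \<le> (\<Sum>p\<in>I. (?y p)\<^sup>2)"
    by (simp_all add: sum_nonneg)
  ultimately have N: "N > 0" unfolding N_def by linarith
  have re: "(\<Sum>q\<in>I. a p q * ?x q) = Re \<mu> * ?x p - Im \<mu> * ?y p"
    and im: "(\<Sum>q\<in>I. a p q * ?y q) = Re \<mu> * ?y p + Im \<mu> * ?x p" if "p \<in> I" for p
    using arg_cong[OF \<phi>[OF that], of Re] arg_cong[OF \<phi>[OF that], of Im] by auto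
  have "quadratic I a ?x + quadratic I a ?y =
     (\<Sum>p\<in>I. ?x p * (\<Sum>q\<in>I. a p q * ?x q)) + (\<Sum>p\<in>I. ?y p * (\<Sum>q\<in>I. a p q * ?y q))"
    by (simp add: quadratic_def sum_distrib_left mult.assoc)
  also have "\<dots> = (\<Sum>p\<in>I. ?x p * (Re \<mu> * ?x p - Im \<mu> * ?y p)) + (\<Sum>p\<in>I. ?y p * (Re \<mu> * ?y p + Im \<mu> * ?x p))"
    using re im by simp
  also have "\<dots> = (\<Sum>p\<in>I. Re \<mu> * ((?x p)\<^sup>2 + (?y p)\<^sup>2))"
    unfolding sum.distrib[symmetric]
    by (intro sum.cong refl) (simp add: power2_eq_square algebra_simps)
  also have "\<dots> = Re \<mu> * N" by (simp add: N_def sum_distrib_left[symmetric] sum.distrib)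
  finally have 1: "quadratic I a ?x + quadratic I a ?y = Re \<mu> * N" .
  have "m * N \<le> quadratic I a ?x + quadratic I a ?y"
    using g by (auto simp: ground_state_def N_def distrib_left intro: add_mono)
  with 1 N show "m \<le> Re \<mu>" by simp
qed

lemma ground_state_eigenvalue:
  assumes "ground_state I a m z"
  shows "eigenvalue_on I (\<lambda>p q. complex_of_real (a p q)) (complex_of_real m)"
  unfolding eigenvalue_on_def
proof (intro exI conjI ballI)
  show "\<exists>p\<in>I. complex_of_real (z p) \<noteq> 0" using assms by (simp add: ground_state_def)
  fix p assume "p \<in> I"
  then have "(\<Sum>q\<in>I. a p q * z q) = m * z p" using assms by (simp add: ground_state_def)
  then show "(\<Sum>q\<in>I. complex_of_real (a p q) * complex_of_real (z q)) =
     complex_of_real m * complex_of_real (z p)"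
    by (metis (mono_tags, lifting) of_real_mult of_real_sum sum.cong)
qed

lemma sum_extend_zero:
  fixes f :: "'i \<Rightarrow> 'b::comm_monoid_add"
  assumes "finite J" "I \<subseteq> J" "\<And>p. p \<in> J - I \<Longrightarrow> f p = 0"
  shows "sum f J = sum f I"
  by (rule sum.mono_neutral_right) (use assms in auto)

lemma quadratic_extend_zero:
  assumes "finite J" "I \<subseteq> J" "\<And>p. p \<in> J - I \<Longrightarrow> \<phi> p = 0"
  shows "quadratic J a \<phi> = quadratic I a \<phi>"
proof -
  have "quadratic J a \<phi> = (\<Sum>p\<in>I. \<Sum>q\<in>J. \<phi> p * a p q * \<phi> q)"
    unfolding quadratic_def by (rule sum_extend_zero) (use assms in auto)
  also have "\<dots> = quadratic I a \<phi>"
    unfolding quadratic_def by (intro sum.cong refl sum_extend_zero) (use assms in auto)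
  finally show ?thesis .
qed

lemma zero_extension:
  fixes z :: "'i \<Rightarrow> real"
  assumes "finite J" "I \<subseteq> J"
  shows "(\<Sum>p\<in>J. (if p \<in> I then z p else 0)\<^sup>2) = (\<Sum>p\<in>I. (z p)\<^sup>2)"
    and "quadratic J a (\<lambda>p. if p \<in> I then z p else 0) = quadratic I a z"
proof -
  let ?y = "\<lambda>p. if p \<in> I then z p else 0"
  have "(\<Sum>p\<in>J. (?y p)\<^sup>2) = (\<Sum>p\<in>I. (?y p)\<^sup>2)"
    by (rule sum_extend_zero) (use assms in auto)
  then show "(\<Sum>p\<in>J. (?y p)\<^sup>2) = (\<Sum>p\<in>I. (z p)\<^sup>2)" by simp
  have "quadratic J a ?y = quadratic I a ?y"
    by (rule quadratic_extend_zero) (use assms in auto)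
  also have "\<dots> = quadratic I a z" by (rule quadratic_cong) simp
  finally show "quadratic J a ?y = quadratic I a z" .
qed

text \<open>Extended by zero, a ground state on \<open>I\<close> competes in the minimisation on \<open>J\<close>.\<close>

lemma ground_state_mono:
  assumes J: "finite J" "I \<subseteq> J" and gI: "ground_state I a m z" and gJ: "ground_state J a m' z'"
  shows "m' \<le> m"
proof -
  define y where "y p = (if p \<in> I then z p else 0)" for p
  obtain p0 where p0: "p0 \<in> I" "z p0 \<noteq> 0" using gI by (auto simp: ground_state_def)
  have N: "(\<Sum>p\<in>J. (y p)\<^sup>2) = (\<Sum>p\<in>I. (z p)\<^sup>2)"
    unfolding y_def by (rule zero_extension(1)[OF J])
  have "quadratic J a y = quadratic I a z"
    unfolding y_def[abs_def] by (rule zero_extension(2)[OF J])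
  also have "\<dots> = m * (\<Sum>p\<in>I. (z p)\<^sup>2)"
    by (rule quadratic_eigenvector) (use gI in \<open>simp add: ground_state_def\<close>)
  finally have "m' * (\<Sum>p\<in>I. (z p)\<^sup>2) \<le> m * (\<Sum>p\<in>I. (z p)\<^sup>2)"
    using gJ N by (simp add: ground_state_def) metis
  moreover have "0 < (\<Sum>p\<in>I. (z p)\<^sup>2)"
    using sum_squares_pos[of I p0 z] p0 J finite_subset by blast
  ultimately show ?thesis by simp
qed

text \<open>When the two minima agree, the extension by zero is itself a minimiser and thus an eigenvector
  on \<open>J\<close>. The equations in the rows outside \<open>I\<close> are the information gained.\<close>

lemma ground_state_extend:
  assumes J: "finite J" "I \<subseteq> J" and sym: "\<And>p q. p \<in> J \<Longrightarrow> q \<in> J \<Longrightarrow> a p q = a q p"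
    and gI: "ground_state I a m z" and gJ: "ground_state J a m z'" and p: "p \<in> J"
  shows "(\<Sum>q\<in>I. a p q * z q) = m * (if p \<in> I then z p else 0)"
proof -
  define y where "y p = (if p \<in> I then z p else 0)" for p
  have N: "(\<Sum>p\<in>J. (y p)\<^sup>2) = (\<Sum>p\<in>I. (z p)\<^sup>2)"
    unfolding y_def by (rule zero_extension(1)[OF J])
  have "quadratic J a y = quadratic I a z"
    unfolding y_def[abs_def] by (rule zero_extension(2)[OF J])
  also have "\<dots> = m * (\<Sum>p\<in>I. (z p)\<^sup>2)"
    by (rule quadratic_eigenvector) (use gI in \<open>simp add: ground_state_def\<close>)
  finally have y: "quadratic J a y = m * (\<Sum>p\<in>J. (y p)\<^sup>2)" by (simp add: N)
  have "m * (\<Sum>p\<in>J. (\<phi> p)\<^sup>2) \<le> quadratic J a \<phi>" for \<phi>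
    using gJ by (simp add: ground_state_def)
  then have "(\<Sum>q\<in>J. a p q * y q) = m * y p"
    by (intro minimiser_is_eigenvector[where a=a] J(1) sym y p)
  moreover have "(\<Sum>q\<in>J. a p q * y q) = (\<Sum>q\<in>I. a p q * y q)"
    by (rule sum_extend_zero) (use J in \<open>auto simp: y_def\<close>)
  moreover have "\<dots> = (\<Sum>q\<in>I. a p q * z q)" by (simp add: y_def)
  ultimately show ?thesis by (simp add: y_def)
qed

section \<open>Symmetric positive definite weights\<close>

locale matrix_weighted_tree = abstract_tree +
  fixes s :: nat and W :: "'a \<Rightarrow> 'a \<Rightarrow> nat \<Rightarrow> nat \<Rightarrow> real"
  assumes W_edge: "W x y = W y x"
begin

definition lap :: "'a \<times> nat \<Rightarrow> 'a \<times> nat \<Rightarrow> real" where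
  "lap p q = (if fst p = fst q then (\<Sum>u\<in>{u. adj (fst p) u}. W (fst p) u (snd p) (snd q))
     else if adj (fst p) (fst q) then - W (fst p) (fst q) (snd p) (snd q) else 0)"

abbreviation blocks :: "'a set \<Rightarrow> ('a \<times> nat) set" where
  "blocks S \<equiv> S \<times> {..<s}"

lemma finite_blocks: "S \<subseteq> V \<Longrightarrow> finite (blocks S)"
  using finite_subset[OF _ finite_V] by blast

end

locale pd_weighted_tree = matrix_weighted_tree +
  assumes s_pos: "1 \<le> s"
    and W_sym: "\<lbrakk>adj x y; i < s; j < s\<rbrakk> \<Longrightarrow> W x y i j = W x y j i"
    and W_pd: "\<lbrakk>adj x y; i < s; \<xi> i \<noteq> 0\<rbrakk> \<Longrightarrow>
       0 < (\<Sum>i<s. \<Sum>j<s. \<xi> i * W x y i j * \<xi> j)"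
begin

definition form :: "'a \<Rightarrow> 'a \<Rightarrow> (nat \<Rightarrow> real) \<Rightarrow> (nat \<Rightarrow> real) \<Rightarrow> real" where
  "form x y f g = (\<Sum>i<s. \<Sum>j<s. f i * W x y i j * g j)"

lemma form_edge: "form x y f g = form y x f g"
  by (simp add: form_def W_edge[of x y])

lemma form_diff:
  assumes "adj x y"
  shows "form x y (\<lambda>i. f i - g i) (\<lambda>i. f i - g i) =
    (form x y f f - form x y f g) + (form x y g g - form x y g f)"
  by (simp add: form_def algebra_simps sum.distrib sum_subtractf)

lemma form_nonneg: "adj x y \<Longrightarrow> 0 \<le> form x y \<xi> \<xi>"
  using W_pd[of x y _ \<xi>] unfolding form_def
  by (cases "\<exists>i<s. \<xi> i \<noteq> 0") (auto intro: less_imp_le)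

lemma form_eq_0: "adj x y \<Longrightarrow> form x y \<xi> \<xi> \<le> 0 \<Longrightarrow> i < s \<Longrightarrow> \<xi> i = 0"
  using W_pd[of x y i \<xi>] unfolding form_def by force

text \<open>Positive definite matrices are injective.\<close>

lemma W_kernel:
  assumes "adj x y" "\<And>i. i < s \<Longrightarrow> (\<Sum>j<s. W x y i j * \<xi> j) = 0" "i < s"
  shows "\<xi> i = 0"
proof -
  have "form x y \<xi> \<xi> = (\<Sum>i<s. \<xi> i * (\<Sum>j<s. W x y i j * \<xi> j))"
    by (simp add: form_def sum_distrib_left mult.assoc)
  also have "\<dots> = 0" using assms(2) by simp
  finally show ?thesis using form_eq_0[OF assms(1)] assms(3) by simp
qed

lemma lap_sym: "p \<in> blocks S \<Longrightarrow> q \<in> blocks S \<Longrightarrow> lap p q = lap q p"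
  using adj_sym W_sym
  by (auto simp: lap_def W_edge intro!: sum.cong)

text \<open>The Laplacian form is a sum over the edges: distributing the diagonal block at \<open>x\<close> over the
  edges at \<open>x\<close> gives one asymmetric term for every ordered adjacent pair, and adding the terms of
  \<open>(x, y)\<close> and \<open>(y, x)\<close> completes the square.\<close>

lemma quadratic_lap:
  "2 * quadratic (blocks V) lap \<phi> = (\<Sum>x\<in>V. \<Sum>y\<in>V. if adj x y
     then form x y (\<lambda>i. \<phi> (x, i) - \<phi> (y, i)) (\<lambda>i. \<phi> (x, i) - \<phi> (y, i)) else 0)"
proof -
  define F where "F x i = \<phi> (x, i)" for x i
  define T where "T x y = (if adj x y then form x y (F x) (F x) - form x y (F x) (F y) else 0)" for x y
  have diag: "(\<Sum>i<s. \<Sum>j<s. F x i * (\<Sum>u\<in>{u. adj x u}. W x u i j) * F x j) =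
      (\<Sum>y\<in>V. if adj x y then form x y (F x) (F x) else 0)" for x
  proof -
    have "(\<Sum>i<s. \<Sum>j<s. F x i * (\<Sum>u\<in>{u. adj x u}. W x u i j) * F x j) =
        (\<Sum>i<s. \<Sum>j<s. \<Sum>u\<in>{u. adj x u}. F x i * W x u i j * F x j)"
      by (simp add: sum_distrib_left sum_distrib_right)
    also have "\<dots> = (\<Sum>i<s. \<Sum>u\<in>{u. adj x u}. \<Sum>j<s. F x i * W x u i j * F x j)"
      by (intro sum.cong refl sum.swap)
    also have "\<dots> = (\<Sum>u\<in>{u. adj x u}. form x u (F x) (F x))"
      unfolding form_def by (rule sum.swap)
    also have "\<dots> = (\<Sum>y\<in>V. if adj x y then form x y (F x) (F x) else 0)"
      using finite_V adj_in_V2 by (intro sum.mono_neutral_cong_left) auto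
    finally show ?thesis .
  qed
  have row: "(\<Sum>i<s. \<Sum>y\<in>V. \<Sum>j<s. F x i * lap (x, i) (y, j) * F y j) = (\<Sum>y\<in>V. T x y)"
    if x: "x \<in> V" for x
  proof -
    have "(\<Sum>i<s. \<Sum>y\<in>V. \<Sum>j<s. F x i * lap (x, i) (y, j) * F y j) =
        (\<Sum>y\<in>V. \<Sum>i<s. \<Sum>j<s. F x i * lap (x, i) (y, j) * F y j)" by (rule sum.swap)
    also have "\<dots> = (\<Sum>y\<in>V. (if y = x then (\<Sum>y\<in>V. if adj x y then form x y (F x) (F x) else 0) else 0)
        + (if adj x y then - form x y (F x) (F y) else 0))"
    proof (intro sum.cong refl)
      fix y assume "y \<in> V"
      consider "y = x" | "y \<noteq> x" "adj x y" | "y \<noteq> x" "\<not> adj x y" by auto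
      then show "(\<Sum>i<s. \<Sum>j<s. F x i * lap (x, i) (y, j) * F y j) =
         (if y = x then (\<Sum>y\<in>V. if adj x y then form x y (F x) (F x) else 0) else 0)
         + (if adj x y then - form x y (F x) (F y) else 0)"
      proof cases
        case 1 then show ?thesis using adj_irrefl diag[of x] by (simp add: lap_def)
      next
        case 2 then show ?thesis by (simp add: lap_def form_def sum_negf)
      next
        case 3 then show ?thesis by (simp add: lap_def)
      qed
    qed
    also have "\<dots> = (\<Sum>y\<in>V. if adj x y then form x y (F x) (F x) else 0)
        + (\<Sum>y\<in>V. if adj x y then - form x y (F x) (F y) else 0)"
      using x finite_V by (simp add: sum.distrib)
    also have "\<dots> = (\<Sum>y\<in>V. T x y)"
      unfolding sum.distrib[symmetric] by (intro sum.cong refl) (simp add: T_def)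
    finally show ?thesis .
  qed
  have "quadratic (blocks V) lap \<phi> =
      (\<Sum>p\<in>blocks V. \<Sum>y\<in>V. \<Sum>j<s. \<phi> p * lap p (y, j) * \<phi> (y, j))"
    unfolding quadratic_def by (simp add: sum.cartesian_product)
  also have "\<dots> = (\<Sum>x\<in>V. \<Sum>i<s. \<Sum>y\<in>V. \<Sum>j<s. F x i * lap (x, i) (y, j) * F y j)"
    unfolding F_def by (rule sum.cartesian_product')
  also have "\<dots> = (\<Sum>x\<in>V. \<Sum>y\<in>V. T x y)" by (intro sum.cong refl row)
  finally have 1: "quadratic (blocks V) lap \<phi> = (\<Sum>x\<in>V. \<Sum>y\<in>V. T x y)" .
  then have 2: "quadratic (blocks V) lap \<phi> = (\<Sum>x\<in>V. \<Sum>y\<in>V. T y x)"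
    using sum.swap[of T V V] by simp
  have pair: "T x y + T y x = (if adj x y
     then form x y (\<lambda>i. \<phi> (x, i) - \<phi> (y, i)) (\<lambda>i. \<phi> (x, i) - \<phi> (y, i)) else 0)" for x y
    using form_diff[of x y "F x" "F y"] adj_sym[of x y] adj_sym[of y x]
    by (auto simp: T_def F_def form_edge[of y x])
  have "2 * quadratic (blocks V) lap \<phi> = (\<Sum>x\<in>V. \<Sum>y\<in>V. T x y + T y x)"
    using 1 2 by (simp add: sum.distrib)
  then show ?thesis unfolding pair .
qed

text \<open>A vector supported in \<open>S\<close> of energy at most 0 has no jump along any edge, so it is constant on
  the tree and equals its value 0 at a vertex outside \<open>S\<close>.\<close>

lemma ground_state_pos:
  assumes S: "S \<subset> V" and g: "ground_state (blocks S) lap m z"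
  shows "0 < m"
proof (rule ccontr)
  assume neg: "\<not> 0 < m"
  have SV: "S \<subseteq> V" using S by auto
  define y where "y p = (if p \<in> blocks S then z p else 0)" for p
  have "quadratic (blocks V) lap y = quadratic (blocks S) lap z"
    unfolding y_def[abs_def] by (rule zero_extension(2)) (use SV finite_blocks in auto)
  also have "\<dots> = m * (\<Sum>p\<in>blocks S. (z p)\<^sup>2)"
    by (rule quadratic_eigenvector) (use g in \<open>unfold ground_state_def, blast\<close>)
  also have "\<dots> \<le> 0" using neg by (intro mult_nonpos_nonneg sum_nonneg) auto
  finally have Q: "quadratic (blocks V) lap y \<le> 0" .
  define D where "D x w = (if adj x w
     then form x w (\<lambda>i. y (x, i) - y (w, i)) (\<lambda>i. y (x, i) - y (w, i)) else 0)" for x w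
  have D0: "0 \<le> D x w" for x w by (simp add: D_def form_nonneg)
  have sum0: "(\<Sum>x\<in>V. \<Sum>w\<in>V. D x w) \<le> 0" using Q quadratic_lap[of y] by (simp add: D_def)
  have D: "D x w \<le> 0" if "x \<in> V" "w \<in> V" for x w
  proof -
    have "D x w \<le> (\<Sum>w\<in>V. D x w)" using that finite_V D0 by (intro member_le_sum) auto
    also have "\<dots> \<le> (\<Sum>x\<in>V. \<Sum>w\<in>V. D x w)"
      using that finite_V D0 by (intro member_le_sum[of x V "\<lambda>x. \<Sum>w\<in>V. D x w"]) (auto intro: sum_nonneg)
    finally show ?thesis using sum0 by simp
  qed
  have step: "y (x, i) = y (w, i)" if "adj x w" "i < s" for x w i
    using D[of x w] that form_eq_0[OF that(1) _ that(2), of "\<lambda>i. y (x, i) - y (w, i)"]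
      adj_in_V adj_in_V2 by (auto simp: D_def)
  obtain v where v: "v \<in> V" "v \<notin> S" using S by auto
  obtain x i where x: "x \<in> S" "i < s" "z (x, i) \<noteq> 0" using g by (auto simp: ground_state_def)
  have "walk_in V v x" using connected_V v x SV by (auto simp: connected_set_def)
  then have "y (x, i) = y (v, i)"
    unfolding walk_in_def by (induction rule: rtranclp_induct) (use step x(2) in auto)
  then show False using x v by (simp add: y_def)
qed

text \<open>By acyclicity a row of the Laplacian at a vertex outside a connected set sees that set through
  a single edge. Hence no cancellation between different neighbours can occur, even though the
  entries of ground states have no sign when \<open>s > 1\<close>.\<close>

lemma lap_row_component:
  assumes x: "x \<in> V" and C: "connected_set C" "C \<subseteq> V" "x \<notin> C" "c \<in> C" "adj x c"
  shows "(\<Sum>q\<in>blocks C. lap (x, i) q * z q) = - (\<Sum>j<s. W x c i j * z (c, j))"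
proof -
  have zero: "lap (x, i) (y, j) = 0" if "y \<in> C" "y \<noteq> c" for y j
    using attach[OF C(1,2,3) _ C(4), of y] that C by (auto simp: lap_def)
  have "(\<Sum>q\<in>blocks C. lap (x, i) q * z q) = (\<Sum>y\<in>C. \<Sum>j<s. lap (x, i) (y, j) * z (y, j))"
    by (subst sum.cartesian_product) (simp add: case_prod_beta)
  also have "\<dots> = (\<Sum>y\<in>{c}. \<Sum>j<s. lap (x, i) (y, j) * z (y, j))"
    by (rule sum_extend_zero) (use zero C finite_V finite_subset in auto)
  also have "\<dots> = - (\<Sum>j<s. W x c i j * z (c, j))"
    using C by (auto simp: lap_def sum_negf[symmetric] intro!: sum.cong)
  finally show ?thesis .
qed

text \<open>This replaces the positivity of Perron vectors, which fails for matrix weights. If \<open>z\<close>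
  vanished at \<open>r\<close>, its restriction to some component \<open>C\<close> of \<open>S - {r}\<close> would be a ground state both
  on \<open>C\<close> and, extended by zero, on \<open>S\<close>. The row at \<open>r\<close> then forces it to vanish at the neighbour of \<open>r\<close> in
  \<open>C\<close>, against the induction hypothesis for \<open>C\<close>.\<close>

lemma ground_state_nonvanishing:
  assumes "connected_set S" "S \<subseteq> V" "ground_state (blocks S) lap m z" "r \<in> S"
  shows "\<exists>i<s. z (r, i) \<noteq> 0"
  using assms
proof (induction "card S" arbitrary: S z r rule: less_induct)
  case (less S z r)
  note S = less.prems(1,2) and g = less.prems(3) and r = less.prems(4)
  have finS: "finite S" using S(2) finite_V finite_subset by auto
  show ?case
  proof (rule ccontr)
    assume "\<not> ?case"
    then have zr: "z (r, i) = 0" if "i < s" for i using that by auto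
    obtain c0 i0 where c0: "c0 \<in> S" "i0 < s" "z (c0, i0) \<noteq> 0" using g by (auto simp: ground_state_def)
    then have c0r: "c0 \<in> S - {r}" using zr by auto
    define C where "C = component (S - {r}) c0"
    have C: "connected_set C" "C \<subseteq> S - {r}" "c0 \<in> C"
      using connected_set_component component_subset component_self[OF c0r] by (auto simp: C_def)
    have CS: "C \<subseteq> S" "r \<notin> C" "C \<subseteq> V" using C S by auto
    \<comment> \<open>on \<open>C\<close> the only outside neighbour is \<open>r\<close>, where \<open>z\<close> vanishes\<close>
    have eig: "(\<Sum>q\<in>blocks C. lap p q * z q) = m * z p" if p: "p \<in> blocks C" for p
    proof -
      have "(\<Sum>q\<in>blocks S. lap p q * z q) = (\<Sum>q\<in>blocks C. lap p q * z q)"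
      proof (rule sum_extend_zero)
        fix q assume q: "q \<in> blocks S - blocks C"
        show "lap p q * z q = 0"
        proof (cases "fst q = r")
          case True
          then show ?thesis using q zr[of "snd q"] by (cases q) auto
        next
          case False
          then have "\<not> adj (fst p) (fst q)" "fst p \<noteq> fst q"
            using q p component_step[of "fst p" "S - {r}" c0 "fst q"] by (auto simp: C_def)
          then show ?thesis by (simp add: lap_def)
        qed
      qed (use CS finite_blocks S in auto)
      then show ?thesis using g p CS by (auto simp: ground_state_def)
    qed
    have bound: "m * (\<Sum>p\<in>blocks C. (\<phi> p)\<^sup>2) \<le> quadratic (blocks C) lap \<phi>" for \<phi>
    proof -
      let ?y = "\<lambda>p. if p \<in> blocks C then \<phi> p else 0"
      have sub: "finite (blocks S)" "blocks C \<subseteq> blocks S" using CS S finite_blocks by auto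
      have "m * (\<Sum>p\<in>blocks S. (\<psi> p)\<^sup>2) \<le> quadratic (blocks S) lap \<psi>" for \<psi>
        using g by (simp add: ground_state_def)
      from this[of ?y] show ?thesis unfolding zero_extension[OF sub] .
    qed
    have gC: "ground_state (blocks C) lap m z"
      unfolding ground_state_def using eig bound c0 C by blast
    obtain w c where "w \<in> S - C" "c \<in> C" "adj w c"
      using boundary[OF S(1) CS(1), of thesis] C(3) r CS by auto
    moreover from this have "w = r"
      using component_step[of c "S - {r}" c0 w] adj_sym by (auto simp: C_def)
    ultimately have c: "c \<in> C" "adj r c" by auto
    have kernel: "(\<Sum>j<s. W r c i j * z (c, j)) = 0" if "i < s" for i
    proof -
      have "(\<Sum>q\<in>blocks C. lap (r, i) q * z q) = m * (if (r, i) \<in> blocks C then z (r, i) else 0)"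
        by (rule ground_state_extend[OF _ _ _ gC g])
          (use S CS r that finite_blocks lap_sym in auto)
      then show ?thesis using lap_row_component[of r C c i z] C CS c r S by auto
    qed
    have "z (c, i) = 0" if "i < s" for i
      by (rule W_kernel[where \<xi>="\<lambda>j. z (c, j)", OF c(2) kernel that])
    moreover have "card C < card S" using CS r finS by (intro psubset_card_mono) auto
    then have "\<exists>i<s. z (c, i) \<noteq> 0" using less.hyps C(1) CS(3) gC c(1) by blast
    ultimately show False by auto
  qed
qed

text \<open>In case of equality the row at a vertex of \<open>T - S\<close> next to \<open>S\<close> would make the ground state on
  \<open>S\<close> vanish at a vertex of \<open>S\<close>.\<close>

lemma ground_state_strict_mono:
  assumes S: "connected_set S" "S \<noteq> {}" and T: "connected_set T" "S \<subset> T" "T \<subseteq> V"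
    and gS: "ground_state (blocks S) lap m z" and gT: "ground_state (blocks T) lap m' z'"
  shows "m' < m"
proof -
  have fin: "finite (blocks T)" "blocks S \<subseteq> blocks T" using T finite_blocks by auto
  have "m' \<noteq> m"
  proof
    assume "m' = m"
    obtain w r where wr: "w \<in> T - S" "r \<in> S" "adj w r" using boundary[OF T(1), of S] T S by auto
    have SV: "S \<subseteq> V" using T by auto
    have kernel: "(\<Sum>j<s. W w r i j * z (r, j)) = 0" if "i < s" for i
    proof -
      have "(\<Sum>q\<in>blocks S. lap (w, i) q * z q) = m * (if (w, i) \<in> blocks S then z (w, i) else 0)"
        by (rule ground_state_extend[OF fin _ gS]) (use gT \<open>m' = m\<close> wr that lap_sym in auto)
      then show ?thesis using lap_row_component[of w S r i z] S SV T wr by auto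
    qed
    have "z (r, i) = 0" if "i < s" for i
      by (rule W_kernel[where \<xi>="\<lambda>j. z (r, j)", OF wr(3) kernel that])
    then show False using ground_state_nonvanishing[OF S(1) SV gS wr(2)] by auto
  qed
  then show ?thesis using ground_state_mono[OF fin gS gT] by simp
qed

end

section \<open>Eigenvalues of kernels and of matrices\<close>

lemma eigenvalue_on_cong:
  assumes "\<And>p q. p \<in> I \<Longrightarrow> q \<in> I \<Longrightarrow> a p q = b p q"
  shows "eigenvalue_on I a \<mu> \<longleftrightarrow> eigenvalue_on I b \<mu>"
  unfolding eigenvalue_on_def using assms by (simp cong: sum.cong)

lemma eigenvalue_on_reindex:
  assumes h: "bij_betw h J I"
  shows "eigenvalue_on I a \<mu> \<longleftrightarrow> eigenvalue_on J (\<lambda>p q. a (h p) (h q)) \<mu>"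
proof
  assume "eigenvalue_on I a \<mu>"
  then obtain \<phi> where \<phi>: "\<exists>p\<in>I. \<phi> p \<noteq> 0" "\<And>p. p \<in> I \<Longrightarrow> (\<Sum>q\<in>I. a p q * \<phi> q) = \<mu> * \<phi> p"
    by (auto simp: eigenvalue_on_def)
  have "(\<Sum>q\<in>J. a (h p) (h q) * \<phi> (h q)) = \<mu> * \<phi> (h p)" if "p \<in> J" for p
    using \<phi>(2)[of "h p"] bij_betwE[OF h] that
    by (simp add: sum.reindex_bij_betw[OF h, of "\<lambda>q. a (h p) q * \<phi> q"])
  moreover have "\<exists>p\<in>J. \<phi> (h p) \<noteq> 0" using \<phi>(1) h by (auto simp: bij_betw_def)
  ultimately show "eigenvalue_on J (\<lambda>p q. a (h p) (h q)) \<mu>"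
    unfolding eigenvalue_on_def by (intro exI[of _ "\<lambda>p. \<phi> (h p)"]) auto
next
  assume "eigenvalue_on J (\<lambda>p q. a (h p) (h q)) \<mu>"
  then obtain \<phi> where \<phi>: "\<exists>p\<in>J. \<phi> p \<noteq> 0"
    "\<And>p. p \<in> J \<Longrightarrow> (\<Sum>q\<in>J. a (h p) (h q) * \<phi> q) = \<mu> * \<phi> p"
    by (auto simp: eigenvalue_on_def)
  define g where "g = inv_into J h"
  have gh: "g (h p) = p" if "p \<in> J" for p
    using that h by (simp add: g_def bij_betw_def)
  have hg: "h (g p) = p" "g p \<in> J" if "p \<in> I" for p
    using that h by (auto simp: g_def bij_betw_def intro: f_inv_into_f inv_into_into)
  have "(\<Sum>q\<in>I. a p q * \<phi> (g q)) = \<mu> * \<phi> (g p)" if "p \<in> I" for p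
  proof -
    have "(\<Sum>q\<in>I. a p q * \<phi> (g q)) = (\<Sum>q\<in>J. a p (h q) * \<phi> (g (h q)))"
      by (rule sum.reindex_bij_betw[OF h, symmetric])
    also have "\<dots> = (\<Sum>q\<in>J. a (h (g p)) (h q) * \<phi> q)"
      using gh hg that by (intro sum.cong) auto
    finally show ?thesis using \<phi>(2)[of "g p"] hg[OF that] by simp
  qed
  moreover have "\<exists>p\<in>I. \<phi> (g p) \<noteq> 0"
    using \<phi>(1) gh bij_betwE[OF h] by (metis)
  ultimately show "eigenvalue_on I a \<mu>"
    unfolding eigenvalue_on_def by (intro exI[of _ "\<lambda>p. \<phi> (g p)"]) auto
qed

lemma mult_mat_vec_index:
  assumes "A \<in> carrier_mat n n" "v \<in> carrier_vec n" "p < n"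
  shows "(A *\<^sub>v v) $ p = (\<Sum>q<n. A $$ (p, q) * v $ q)"
  using assms by (simp add: scalar_prod_def atLeast0LessThan)

lemma eigenvalue_iff_eigenvalue_on:
  fixes A :: "'a::comm_ring_1 mat"
  assumes A: "A \<in> carrier_mat n n"
  shows "eigenvalue A \<mu> \<longleftrightarrow> eigenvalue_on {..<n} (\<lambda>p q. A $$ (p, q)) \<mu>"
proof
  assume "eigenvalue A \<mu>"
  then obtain v where v: "v \<in> carrier_vec n" "v \<noteq> 0\<^sub>v n" "A *\<^sub>v v = \<mu> \<cdot>\<^sub>v v"
    using A by (auto simp: eigenvalue_def eigenvector_def)
  have "\<exists>p\<in>{..<n}. v $ p \<noteq> 0"
  proof (rule ccontr)
    assume "\<not> ?thesis"
    then have "v = 0\<^sub>v n" using v(1) by (intro eq_vecI) auto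
    then show False using v(2) by simp
  qed
  moreover have "(\<Sum>q<n. A $$ (p, q) * v $ q) = \<mu> * v $ p" if "p < n" for p
    using mult_mat_vec_index[OF A v(1) that] v(1,3) that by simp
  ultimately show "eigenvalue_on {..<n} (\<lambda>p q. A $$ (p, q)) \<mu>"
    unfolding eigenvalue_on_def by (intro exI[of _ "\<lambda>p. v $ p"]) auto
next
  assume "eigenvalue_on {..<n} (\<lambda>p q. A $$ (p, q)) \<mu>"
  then obtain \<phi> p0 where \<phi>: "p0 < n" "\<phi> p0 \<noteq> 0"
    "\<And>p. p < n \<Longrightarrow> (\<Sum>q<n. A $$ (p, q) * \<phi> q) = \<mu> * \<phi> p"
    by (auto simp: eigenvalue_on_def)
  define v where "v = vec n \<phi>"
  have v: "v \<in> carrier_vec n" by (simp add: v_def)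
  have "A *\<^sub>v v = \<mu> \<cdot>\<^sub>v v"
  proof (rule eq_vecI)
    fix p assume "p < dim_vec (\<mu> \<cdot>\<^sub>v v)"
    then have p: "p < n" by (simp add: v_def)
    have "(A *\<^sub>v v) $ p = (\<Sum>q<n. A $$ (p, q) * \<phi> q)"
      unfolding mult_mat_vec_index[OF A v p] by (simp add: v_def)
    then show "(A *\<^sub>v v) $ p = (\<mu> \<cdot>\<^sub>v v) $ p" using \<phi>(3)[OF p] p by (simp add: v_def)
  qed (use A v in auto)
  moreover have "v $ p0 \<noteq> 0\<^sub>v n $ p0" using \<phi> by (simp add: v_def)
  then have "v \<noteq> 0\<^sub>v n" by auto
  ultimately show "eigenvalue A \<mu>"
    using v A by (auto simp: eigenvalue_def eigenvector_def)
qed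

lemma eigenvalue_on_as_matrix:
  fixes a :: "'i \<Rightarrow> 'i \<Rightarrow> 'a::comm_ring_1"
  assumes "finite I"
  shows "\<exists>A :: 'a mat. A \<in> carrier_mat (card I) (card I) \<and>
    (\<forall>\<mu>. eigenvalue_on I a \<mu> \<longleftrightarrow> eigenvalue A \<mu>) \<and>
    (\<forall>\<mu>. eigenvalue_on I (\<lambda>p q. a q p) \<mu> \<longleftrightarrow> eigenvalue (transpose_mat A) \<mu>)"
proof -
  obtain h where h: "bij_betw h {..<card I} I"
    using ex_bij_betw_nat_finite[OF assms] by (auto simp: atLeast0LessThan)
  define A where "A = mat (card I) (card I) (\<lambda>(p, q). a (h p) (h q))"
  have A: "A \<in> carrier_mat (card I) (card I)" by (simp add: A_def)
  show ?thesis
  proof (intro exI[of _ A] conjI allI A)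
    fix \<mu>
    show "eigenvalue_on I a \<mu> \<longleftrightarrow> eigenvalue A \<mu>"
      unfolding eigenvalue_iff_eigenvalue_on[OF A] eigenvalue_on_reindex[OF h]
      by (rule eigenvalue_on_cong) (simp add: A_def)
    show "eigenvalue_on I (\<lambda>p q. a q p) \<mu> \<longleftrightarrow> eigenvalue (transpose_mat A) \<mu>"
      unfolding eigenvalue_iff_eigenvalue_on[OF transpose_carrier_mat[THEN iffD2, OF A]] eigenvalue_on_reindex[OF h]
      by (rule eigenvalue_on_cong) (simp add: A_def)
  qed
qed

lemma eigenvalue_on_transpose:
  fixes a :: "'i \<Rightarrow> 'i \<Rightarrow> 'a::field"
  assumes "finite I"
  shows "eigenvalue_on I (\<lambda>p q. a q p) \<mu> \<longleftrightarrow> eigenvalue_on I a \<mu>"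
proof -
  obtain A where A: "A \<in> carrier_mat (card I) (card I)"
    "\<And>\<mu>. eigenvalue_on I a \<mu> \<longleftrightarrow> eigenvalue A \<mu>"
    "\<And>\<mu>. eigenvalue_on I (\<lambda>p q. a q p) \<mu> \<longleftrightarrow> eigenvalue (transpose_mat A) \<mu>"
    using eigenvalue_on_as_matrix[OF assms, of a] by blast
  show ?thesis
    unfolding A(2,3) eigenvalue_root_char_poly[OF A(1)]
      eigenvalue_root_char_poly[OF transpose_carrier_mat[THEN iffD2, OF A(1)]] char_poly_transpose_mat[OF A(1)] ..
qed

lemma eigenvalues_on_finite_nonempty:
  fixes a :: "'i \<Rightarrow> 'i \<Rightarrow> complex"
  assumes "finite I"
  shows "finite {\<mu>. eigenvalue_on I a \<mu>}" "I \<noteq> {} \<Longrightarrow> {\<mu>. eigenvalue_on I a \<mu>} \<noteq> {}"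
proof -
  obtain A where A: "A \<in> carrier_mat (card I) (card I)"
    "\<And>\<mu>. eigenvalue_on I a \<mu> \<longleftrightarrow> eigenvalue A \<mu>"
    using eigenvalue_on_as_matrix[OF assms, of a] by blast
  have eq: "{\<mu>. eigenvalue_on I a \<mu>} = spectrum A" by (simp add: A(2) spectrum_def)
  show "finite {\<mu>. eigenvalue_on I a \<mu>}" unfolding eq using card_finite_spectrum[OF A(1)] by simp
  show "I \<noteq> {} \<Longrightarrow> {\<mu>. eigenvalue_on I a \<mu>} \<noteq> {}"
    unfolding eq using spectrum_non_empty[OF A(1)] assms by (simp add: card_gt_0_iff)
qed

lemma eigenvalue_on_extend:
  assumes fin: "finite I" and J: "J \<subseteq> I" and dec: "\<And>p q. p \<in> I - J \<Longrightarrow> q \<in> J \<Longrightarrow> a p q = 0"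
    and e: "eigenvalue_on J a \<mu>"
  shows "eigenvalue_on I a \<mu>"
proof -
  obtain \<phi> p0 where \<phi>: "p0 \<in> J" "\<phi> p0 \<noteq> 0"
    "\<And>p. p \<in> J \<Longrightarrow> (\<Sum>q\<in>J. a p q * \<phi> q) = \<mu> * \<phi> p"
    using e by (auto simp: eigenvalue_on_def)
  define \<psi> where "\<psi> p = (if p \<in> J then \<phi> p else 0)" for p
  have "(\<Sum>q\<in>I. a p q * \<psi> q) = \<mu> * \<psi> p" if "p \<in> I" for p
  proof -
    have "(\<Sum>q\<in>I. a p q * \<psi> q) = (\<Sum>q\<in>J. a p q * \<psi> q)"
      by (rule sum_extend_zero) (use fin J in \<open>auto simp: \<psi>_def\<close>)
    also have "\<dots> = (\<Sum>q\<in>J. a p q * \<phi> q)" by (simp add: \<psi>_def)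
    also have "\<dots> = \<mu> * \<psi> p"
      using \<phi>(3)[of p] dec[of p] that by (cases "p \<in> J") (auto simp: \<psi>_def)
    finally show ?thesis .
  qed
  moreover have "\<exists>p\<in>I. \<psi> p \<noteq> 0" using \<phi> J by (auto simp: \<psi>_def)
  ultimately show ?thesis unfolding eigenvalue_on_def by blast
qed

text \<open>Block triangular kernels. The eigenvectors of one diagonal block are extended by zero;
  those of the other are not, but the transposed kernel has the same eigenvalues.\<close>

lemma eigenvalue_on_block_triangular:
  fixes a :: "'i \<Rightarrow> 'i \<Rightarrow> 'a::field"
  assumes fin: "finite I" "finite J" and dis: "I \<inter> J = {}"
    and dec: "\<And>p q. p \<in> I \<Longrightarrow> q \<in> J \<Longrightarrow> a p q = 0"
  shows "eigenvalue_on (I \<union> J) a \<mu> \<longleftrightarrow> eigenvalue_on I a \<mu> \<or> eigenvalue_on J a \<mu>"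
proof
  assume "eigenvalue_on (I \<union> J) a \<mu>"
  then obtain \<phi> where \<phi>: "\<exists>p\<in>I \<union> J. \<phi> p \<noteq> 0"
    "\<And>p. p \<in> I \<union> J \<Longrightarrow> (\<Sum>q\<in>I \<union> J. a p q * \<phi> q) = \<mu> * \<phi> p"
    unfolding eigenvalue_on_def by blast
  show "eigenvalue_on I a \<mu> \<or> eigenvalue_on J a \<mu>"
  proof (cases "\<exists>p\<in>I. \<phi> p \<noteq> 0")
    case True
    have "(\<Sum>q\<in>I. a p q * \<phi> q) = \<mu> * \<phi> p" if "p \<in> I" for p
    proof -
      have "(\<Sum>q\<in>I \<union> J. a p q * \<phi> q) = (\<Sum>q\<in>I. a p q * \<phi> q)"
        by (rule sum_extend_zero) (use fin dec that in auto)
      then show ?thesis using \<phi>(2)[of p] that by simp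
    qed
    then show ?thesis using True unfolding eigenvalue_on_def by blast
  next
    case False
    have "(\<Sum>q\<in>J. a p q * \<phi> q) = \<mu> * \<phi> p" if "p \<in> J" for p
    proof -
      have "(\<Sum>q\<in>I \<union> J. a p q * \<phi> q) = (\<Sum>q\<in>J. a p q * \<phi> q)"
        by (rule sum_extend_zero) (use fin False in auto)
      then show ?thesis using \<phi>(2)[of p] that by simp
    qed
    then show ?thesis using False \<phi>(1) unfolding eigenvalue_on_def by blast
  qed
next
  have "eigenvalue_on (I \<union> J) a \<mu>" if "eigenvalue_on J a \<mu>"
    by (rule eigenvalue_on_extend[OF _ _ _ that]) (use fin dec in auto)
  moreover have "eigenvalue_on (I \<union> J) (\<lambda>p q. a q p) \<mu>" if "eigenvalue_on I (\<lambda>p q. a q p) \<mu>"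
    by (rule eigenvalue_on_extend[OF _ _ _ that]) (use fin dec in auto)
  moreover assume "eigenvalue_on I a \<mu> \<or> eigenvalue_on J a \<mu>"
  ultimately show "eigenvalue_on (I \<union> J) a \<mu>"
    using eigenvalue_on_transpose[OF fin(1), of a \<mu>]
      eigenvalue_on_transpose[OF finite_UnI[OF fin], of a \<mu>] by blast
qed

text \<open>A direct sum of blocks: eigenvectors restrict to each block and extend by zero from it.\<close>

lemma eigenvalue_on_decoupled:
  fixes a :: "'i \<Rightarrow> 'i \<Rightarrow> 'a::field"
  assumes fin: "finite I" and I: "I = \<Union>F"
    and dec: "\<And>J p q. J \<in> F \<Longrightarrow> p \<in> J \<Longrightarrow> q \<in> I - J \<Longrightarrow> a p q = 0 \<and> a q p = 0"
  shows "eigenvalue_on I a \<mu> \<longleftrightarrow> (\<exists>J\<in>F. eigenvalue_on J a \<mu>)"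
proof
    assume "\<exists>J\<in>F. eigenvalue_on J a \<mu>"
    then obtain J where J: "J \<in> F" and e: "eigenvalue_on J a \<mu>" by blast
    show "eigenvalue_on I a \<mu>"
      by (rule eigenvalue_on_extend[OF fin _ _ e]) (use J I dec[OF J] in auto)
  next
    assume "eigenvalue_on I a \<mu>"
    then obtain \<phi> p0 where \<phi>: "p0 \<in> I" "\<phi> p0 \<noteq> 0"
      "\<And>p. p \<in> I \<Longrightarrow> (\<Sum>q\<in>I. a p q * \<phi> q) = \<mu> * \<phi> p"
      by (auto simp: eigenvalue_on_def)
    then obtain J where J: "J \<in> F" "p0 \<in> J" using I by auto
    have "(\<Sum>q\<in>J. a p q * \<phi> q) = \<mu> * \<phi> p" if "p \<in> J" for p
    proof -
      have "(\<Sum>q\<in>I. a p q * \<phi> q) = (\<Sum>q\<in>J. a p q * \<phi> q)"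
        by (rule sum_extend_zero) (use fin I J dec[OF J(1) that] in auto)
      then show ?thesis using \<phi>(3)[of p] that J I by auto
    qed
    then show "\<exists>J\<in>F. eigenvalue_on J a \<mu>" using J \<phi>(2) unfolding eigenvalue_on_def by blast
qed

lemma eigenvalue_on_inverse:
  fixes a b :: "'i \<Rightarrow> 'i \<Rightarrow> 'a::field"
  assumes fin: "finite I"
    and ab: "\<And>p q. p \<in> I \<Longrightarrow> q \<in> I \<Longrightarrow> (\<Sum>r\<in>I. a p r * b r q) = (if p = q then 1 else 0)"
    and e: "eigenvalue_on I b \<mu>"
  shows "\<mu> \<noteq> 0" "eigenvalue_on I a (inverse \<mu>)"
proof -
  obtain \<phi> p0 where \<phi>: "p0 \<in> I" "\<phi> p0 \<noteq> 0"
    "\<And>p. p \<in> I \<Longrightarrow> (\<Sum>q\<in>I. b p q * \<phi> q) = \<mu> * \<phi> p"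
    using e by (auto simp: eigenvalue_on_def)
  have eq: "\<mu> * (\<Sum>r\<in>I. a p r * \<phi> r) = \<phi> p" if p: "p \<in> I" for p
  proof -
    have "\<mu> * (\<Sum>r\<in>I. a p r * \<phi> r) = (\<Sum>r\<in>I. a p r * (\<Sum>q\<in>I. b r q * \<phi> q))"
      unfolding sum_distrib_left[of \<mu>]
      by (intro sum.cong refl) (subst \<phi>(3), assumption, simp add: mult_ac)
    also have "\<dots> = (\<Sum>r\<in>I. \<Sum>q\<in>I. a p r * b r q * \<phi> q)"
      by (simp add: sum_distrib_left mult.assoc)
    also have "\<dots> = (\<Sum>q\<in>I. (\<Sum>r\<in>I. a p r * b r q) * \<phi> q)"
      by (subst sum.swap) (simp add: sum_distrib_right)
    also have "\<dots> = (\<Sum>q\<in>I. if p = q then \<phi> q else 0)"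
      by (intro sum.cong refl) (simp add: ab p)
    also have "\<dots> = \<phi> p" using p fin by simp
    finally show ?thesis .
  qed
  show \<mu>: "\<mu> \<noteq> 0" using eq[OF \<phi>(1)] \<phi>(2) by auto
  have "(\<Sum>r\<in>I. a p r * \<phi> r) = inverse \<mu> * \<phi> p" if "p \<in> I" for p
    using eq[OF that] \<mu> by (simp add: field_simps)
  then show "eigenvalue_on I a (inverse \<mu>)" using \<phi>(1,2) unfolding eigenvalue_on_def by blast
qed

text \<open>\<open>pick\<close> is inverse to counting the smaller elements.\<close>

lemma bij_betw_pick:
  assumes "finite I"
  shows "bij_betw (pick I) {..<card I} I"
proof -
  have "(\<lambda>i. card {a\<in>I. a < i}) ` I \<subseteq> {..<card I}"
    using assms by (auto intro!: psubset_card_mono)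
  moreover have "inj_on (\<lambda>i. card {a\<in>I. a < i}) I"
    by (rule inj_on_inverseI[of _ "pick I"]) (rule pick_card_in_set)
  ultimately have "(\<lambda>i. card {a\<in>I. a < i}) ` I = {..<card I}"
    by (intro card_subset_eq) (auto simp: card_image)
  then show ?thesis
    by (intro bij_betw_byWitness[of _ "\<lambda>i. card {a\<in>I. a < i}"])
      (auto simp: pick_card_in_set card_pick_le pick_in_set_le)
qed

lemma submatrix_carrier:
  assumes "A \<in> carrier_mat n n" "I \<subseteq> {..<n}"
  shows "submatrix A I I \<in> carrier_mat (card I) (card I)"
    and "\<And>p q. p < card I \<Longrightarrow> q < card I \<Longrightarrow> submatrix A I I $$ (p, q) = A $$ (pick I p, pick I q)"
proof -
  have "{i. i < n \<and> i \<in> I} = I" using assms by auto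
  then show "submatrix A I I \<in> carrier_mat (card I) (card I)"
    "\<And>p q. p < card I \<Longrightarrow> q < card I \<Longrightarrow> submatrix A I I $$ (p, q) = A $$ (pick I p, pick I q)"
    using assms by (auto simp: submatrix_def)
qed

lemma real_spectral_radius_submatrix:
  assumes A: "A \<in> carrier_mat n n" and I: "I \<subseteq> {..<n}"
  shows "real_spectral_radius (submatrix A I I) =
    Max (norm ` {\<mu>. eigenvalue_on I (\<lambda>p q. complex_of_real (A $$ (p, q))) \<mu>})"
proof -
  let ?B = "map_mat complex_of_real (submatrix A I I)"
  have fin: "finite I" using I finite_subset by blast
  have B: "?B \<in> carrier_mat (card I) (card I)" using submatrix_carrier[OF A I] by simp
  have eq: "eigenvalue ?B \<mu> \<longleftrightarrow> eigenvalue_on I (\<lambda>p q. complex_of_real (A $$ (p, q))) \<mu>" for \<mu>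
    unfolding eigenvalue_iff_eigenvalue_on[OF B] eigenvalue_on_reindex[OF bij_betw_pick[OF fin]]
    by (rule eigenvalue_on_cong) (use submatrix_carrier[OF A I] in auto)
  show ?thesis unfolding real_spectral_radius_def spectral_radius_def spectrum_def
    by (rule arg_cong[where f="\<lambda>S. Max (norm ` S)"], rule Collect_cong, rule eq)
qed

lemma real_spectral_radius_whole:
  assumes A: "A \<in> carrier_mat n n"
  shows "real_spectral_radius A =
    Max (norm ` {\<mu>. eigenvalue_on {..<n} (\<lambda>p q. complex_of_real (A $$ (p, q))) \<mu>})"
proof -
  let ?B = "map_mat complex_of_real A"
  have B: "?B \<in> carrier_mat n n" using A by simp
  have eq: "eigenvalue ?B \<mu> \<longleftrightarrow> eigenvalue_on {..<n} (\<lambda>p q. complex_of_real (A $$ (p, q))) \<mu>" for \<mu>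
    unfolding eigenvalue_iff_eigenvalue_on[OF B]
    by (rule eigenvalue_on_cong) (use A in auto)
  show ?thesis unfolding real_spectral_radius_def spectral_radius_def spectrum_def
    by (rule arg_cong[where f="\<lambda>S. Max (norm ` S)"], rule Collect_cong, rule eq)
qed

text \<open>For an invertible kernel this is the spectral radius of its inverse, expressed without
  inverting.\<close>

definition inverse_radius :: "'i set \<Rightarrow> ('i \<Rightarrow> 'i \<Rightarrow> complex) \<Rightarrow> real" where
  "inverse_radius I a = Max ((\<lambda>\<mu>. inverse (norm \<mu>)) ` {\<mu>. eigenvalue_on I a \<mu>})"

lemma inverse_radius_attained:
  assumes "finite I" "I \<noteq> {}"
  obtains \<mu> where "eigenvalue_on I a \<mu>" "inverse_radius I a = inverse (norm \<mu>)"
proof -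
  let ?E = "{\<mu>. eigenvalue_on I a \<mu>}"
  have "inverse_radius I a \<in> (\<lambda>\<mu>. inverse (norm \<mu>)) ` ?E"
    unfolding inverse_radius_def using eigenvalues_on_finite_nonempty[OF assms(1), of a] assms(2)
    by (intro Max_in) auto
  then show thesis using that by auto
qed

lemma inverse_radius_ge:
  "finite I \<Longrightarrow> eigenvalue_on I a \<mu> \<Longrightarrow> inverse (norm \<mu>) \<le> inverse_radius I a"
  unfolding inverse_radius_def using eigenvalues_on_finite_nonempty(1)[of I a]
  by (intro Max_ge) auto

text \<open>The hypothesis is about complex vectors because all spectra are complex; a real kernel vector
  of \<open>R\<close> is in particular a complex one.\<close>

lemma mat_inverse_exists:
  fixes R :: "real mat"
  assumes R: "R \<in> carrier_mat n n"
    and n0: "\<not> eigenvalue_on {..<n} (\<lambda>p q. complex_of_real (R $$ (p, q))) 0"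
  obtains N where "mat_inverse R = Some N" "N \<in> carrier_mat n n" "R * N = 1\<^sub>m n" "N * R = 1\<^sub>m n"
proof -
  have "det R \<noteq> 0"
  proof
    assume "det R = 0"
    then obtain v where v: "v \<in> carrier_vec n" "v \<noteq> 0\<^sub>v n" "R *\<^sub>v v = 0\<^sub>v n"
      using det_0_iff_vec_prod_zero_field[OF R] by auto
    then have "eigenvalue R 0" using R by (auto simp: eigenvalue_def eigenvector_def intro!: exI[of _ v])
    then obtain \<phi> where \<phi>: "\<exists>p<n. \<phi> p \<noteq> 0" "\<And>p. p < n \<Longrightarrow> (\<Sum>q<n. R $$ (p, q) * \<phi> q) = 0"
      by (auto simp: eigenvalue_iff_eigenvalue_on[OF R] eigenvalue_on_def)
    have "(\<Sum>q<n. complex_of_real (R $$ (p, q)) * complex_of_real (\<phi> q)) = 0" if "p < n" for p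
      using arg_cong[OF \<phi>(2)[OF that], of complex_of_real] by simp
    then have "eigenvalue_on {..<n} (\<lambda>p q. complex_of_real (R $$ (p, q))) 0"
      unfolding eigenvalue_on_def using \<phi>(1)
      by (intro exI[of _ "\<lambda>q. complex_of_real (\<phi> q)"]) auto
    then show False using n0 by simp
  qed
  then have "R \<in> Units (ring_mat TYPE(real) n ())" using det_non_zero_imp_unit[OF R] by simp
  then obtain N where "mat_inverse R = Some N"
    using mat_inverse(1)[OF R, of "()"] by (cases "mat_inverse R") auto
  then show thesis using that mat_inverse(2)[OF R] by blast
qed

text \<open>As \<open>R\<close> does not couple \<open>I\<close> with its complement, the blocks of \<open>R\<close> and \<open>N\<close> on \<open>I\<close> are inverse to
  each other, and inversion turns the eigenvalues of the one into those of the other.\<close>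

lemma eigenvalues_of_inverse_block:
  fixes R N :: "real mat"
  assumes R: "R \<in> carrier_mat n n" and N: "N \<in> carrier_mat n n"
    and inv: "R * N = 1\<^sub>m n" "N * R = 1\<^sub>m n" and I: "I \<subseteq> {..<n}"
    and dec: "\<And>p q. p \<in> I \<Longrightarrow> q \<in> {..<n} - I \<Longrightarrow> R $$ (p, q) = 0 \<and> R $$ (q, p) = 0"
  shows "Max (norm ` {\<mu>. eigenvalue_on I (\<lambda>p q. complex_of_real (N $$ (p, q))) \<mu>}) =
    inverse_radius I (\<lambda>p q. complex_of_real (R $$ (p, q)))"
proof -
  have fin: "finite I" using I finite_subset by blast
  let ?N = "\<lambda>p q. complex_of_real (N $$ (p, q))" and ?R = "\<lambda>p q. complex_of_real (R $$ (p, q))"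
  have prod: "(\<Sum>r<n. A $$ (p, r) * B $$ (r, q)) = (if p = q then 1 else 0)"
    if "A \<in> carrier_mat n n" "B \<in> carrier_mat n n" "A * B = 1\<^sub>m n" "p \<in> I" "q \<in> I" for A B :: "real mat" and p q
  proof -
    have pq: "p < n" "q < n" using that I by auto
    have "(A * B) $$ (p, q) = (\<Sum>r<n. A $$ (p, r) * B $$ (r, q))"
      using that(1,2) pq by (simp add: scalar_prod_def atLeast0LessThan)
    then show ?thesis using that(3) pq by simp
  qed
  have RN: "(\<Sum>r\<in>I. ?R p r * ?N r q) = (if p = q then 1 else 0)" if "p \<in> I" "q \<in> I" for p q
  proof -
    have "(\<Sum>r<n. R $$ (p, r) * N $$ (r, q)) = (\<Sum>r\<in>I. R $$ (p, r) * N $$ (r, q))"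
      by (rule sum_extend_zero) (use I dec that in auto)
    then have "(\<Sum>r\<in>I. R $$ (p, r) * N $$ (r, q)) = (if p = q then 1 else 0)"
      using prod[OF R N inv(1) that] by simp
    from arg_cong[OF this, of complex_of_real] show ?thesis by simp
  qed
  have NR: "(\<Sum>r\<in>I. ?N p r * ?R r q) = (if p = q then 1 else 0)" if "p \<in> I" "q \<in> I" for p q
  proof -
    have "(\<Sum>r<n. N $$ (p, r) * R $$ (r, q)) = (\<Sum>r\<in>I. N $$ (p, r) * R $$ (r, q))"
      by (rule sum_extend_zero) (use I dec that in auto)
    then have "(\<Sum>r\<in>I. N $$ (p, r) * R $$ (r, q)) = (if p = q then 1 else 0)"
      using prod[OF N R inv(2) that] by simp
    from arg_cong[OF this, of complex_of_real] show ?thesis by simp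
  qed
  have "norm ` {\<mu>. eigenvalue_on I ?N \<mu>} = (\<lambda>\<mu>. inverse (norm \<mu>)) ` {\<mu>. eigenvalue_on I ?R \<mu>}"
  proof (intro equalityI subsetI)
    fix x assume "x \<in> norm ` {\<mu>. eigenvalue_on I ?N \<mu>}"
    then obtain \<mu> where "eigenvalue_on I ?N \<mu>" "x = norm \<mu>" by auto
    then show "x \<in> (\<lambda>\<mu>. inverse (norm \<mu>)) ` {\<mu>. eigenvalue_on I ?R \<mu>}"
      using eigenvalue_on_inverse[OF fin RN] by (intro image_eqI[of _ _ "inverse \<mu>"]) (auto simp: norm_inverse)
  next
    fix x assume "x \<in> (\<lambda>\<mu>. inverse (norm \<mu>)) ` {\<mu>. eigenvalue_on I ?R \<mu>}"
    then obtain \<mu> where "eigenvalue_on I ?R \<mu>" "x = inverse (norm \<mu>)" by auto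
    then show "x \<in> norm ` {\<mu>. eigenvalue_on I ?N \<mu>}"
      using eigenvalue_on_inverse[OF fin NR] by (intro image_eqI[of _ _ "inverse \<mu>"]) (auto simp: norm_inverse)
  qed
  then show ?thesis by (simp add: inverse_radius_def)
qed

section \<open>The branch value and its strict monotonicity\<close>

context matrix_weighted_tree
begin

abbreviation spectral_point :: "'a set \<Rightarrow> complex \<Rightarrow> bool" where
  "spectral_point S \<equiv> eigenvalue_on (blocks S) (\<lambda>p q. complex_of_real (lap p q))"

text \<open>The spectral radius of the bottleneck matrix of a branch \<open>S\<close>, defined for every set of vertices so
  that branches at different vertices can be compared.\<close>

definition radius :: "'a set \<Rightarrow> real" where
  "radius S = inverse_radius (blocks S) (\<lambda>p q. complex_of_real (lap p q))"

end

context pd_weighted_tree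
begin

lemma ground_state_on_blocks:
  assumes "S \<subseteq> V" "S \<noteq> {}"
  obtains m z where "ground_state (blocks S) lap m z"
proof -
  have "\<exists>m z. ground_state (blocks S) lap m z"
    by (rule ground_state_exists[OF finite_blocks[OF assms(1)] _ lap_sym])
      (use assms(2) s_pos in \<open>auto simp: lessThan_empty_iff\<close>)
  then show thesis using that by blast
qed

lemma spectral_point_ge:
  assumes "S \<subset> V" "ground_state (blocks S) lap m z" "spectral_point S \<mu>"
  shows "m \<le> norm \<mu>"
proof -
  have "finite (blocks S)" using assms finite_blocks by auto
  then have "m \<le> Re \<mu>" by (rule ground_state_least[OF _ assms(2,3)])
  then show ?thesis using complex_Re_le_cmod order_trans by blast
qed

lemma zero_not_spectral_point:
  assumes "S \<subset> V"
  shows "\<not> spectral_point S 0"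
proof
  assume e: "spectral_point S 0"
  then have "S \<noteq> {}" by (auto simp: eigenvalue_on_def)
  then obtain m z where g: "ground_state (blocks S) lap m z"
    using ground_state_on_blocks assms by blast
  show False using spectral_point_ge[OF assms g e] ground_state_pos[OF assms g] by simp
qed

text \<open>All eigenvalues have modulus at least \<open>m\<close>, and \<open>m\<close> is one of them.\<close>

lemma radius_eq:
  assumes S: "S \<subset> V" "S \<noteq> {}" and g: "ground_state (blocks S) lap m z"
  shows "radius S = inverse m"
proof -
  have fin: "finite (blocks S)" "blocks S \<noteq> {}" using S finite_blocks s_pos by (auto simp: lessThan_empty_iff)
  have m: "0 < m" by (rule ground_state_pos[OF S(1) g])
  have "inverse m \<le> radius S"
    using inverse_radius_ge[OF fin(1) ground_state_eigenvalue[OF g]] m by (simp add: radius_def)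
  moreover obtain \<mu> where \<mu>: "spectral_point S \<mu>" "radius S = inverse (norm \<mu>)"
    unfolding radius_def by (rule inverse_radius_attained[OF fin])
  then have "radius S \<le> inverse m"
    using spectral_point_ge[OF S(1) g \<mu>(1)] m by (simp add: le_imp_inverse_le)
  ultimately show ?thesis by simp
qed

lemma radius_strict_mono:
  assumes "connected_set S" "connected_set T" "S \<noteq> {}" "S \<subset> T" "T \<subset> V"
  shows "radius S < radius T"
proof -
  have ST: "S \<subset> V" "S \<subseteq> V" "T \<subseteq> V" "T \<noteq> {}" using assms by auto
  obtain m z where g: "ground_state (blocks S) lap m z"
    using ground_state_on_blocks[OF ST(2) assms(3)] .
  obtain m' z' where g': "ground_state (blocks T) lap m' z'"
    using ground_state_on_blocks[OF ST(3,4)] .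
  have "m' < m"
    by (rule ground_state_strict_mono[OF assms(1,3,2,4) ST(3) g g'])
  then show ?thesis
    using radius_eq[OF ST(1) assms(3) g] radius_eq[OF assms(5) ST(4) g'] ground_state_pos[OF assms(5) g']
    by (simp add: less_imp_inverse_less)
qed

end

section \<open>Triangular weights\<close>

text \<open>Ordering the pairs \<open>(v, i)\<close> by the inner index first makes the whole Laplacian block triangular,
  with one diagonal block for each \<open>i\<close>: the scalar Laplacian whose weights are the \<open>i\<close>-th diagonal
  entries. These weights are positive, so each diagonal block is covered by the symmetric case with
  \<open>s = 1\<close>.\<close>

locale triangular_weighted_tree = matrix_weighted_tree +
  assumes s_pos: "1 \<le> s"
    and diagonal_pos: "\<lbrakk>adj x y; i < s\<rbrakk> \<Longrightarrow> 0 < W x y i i"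
    and triangular: "(\<forall>x y i j. adj x y \<longrightarrow> i < j \<longrightarrow> j < s \<longrightarrow> W x y i j = 0) \<or>
      (\<forall>x y i j. adj x y \<longrightarrow> i < j \<longrightarrow> j < s \<longrightarrow> W x y j i = 0)"
begin

abbreviation scalar_weight :: "nat \<Rightarrow> 'a \<Rightarrow> 'a \<Rightarrow> nat \<Rightarrow> nat \<Rightarrow> real" where
  "scalar_weight k \<equiv> \<lambda>x y i j. W x y k k"

lemma scalar_pd: "k < s \<Longrightarrow> pd_weighted_tree V adj 1 (scalar_weight k)"
proof unfold_locales
  fix x y i and \<xi> :: "nat \<Rightarrow> real"
  assume "k < s" "adj x y" "i < (1::nat)" "\<xi> i \<noteq> 0"
  then have "0 < W x y k k * (\<xi> 0)\<^sup>2" using diagonal_pos by simp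
  then show "0 < (\<Sum>i<1. \<Sum>j<1. \<xi> i * W x y k k * \<xi> j)"
    by (simp add: power2_eq_square mult_ac)
qed (auto simp: W_edge)

abbreviation scalar_lap :: "nat \<Rightarrow> 'a \<times> nat \<Rightarrow> 'a \<times> nat \<Rightarrow> real" where
  "scalar_lap k \<equiv> matrix_weighted_tree.lap adj (scalar_weight k)"

abbreviation scalar_point :: "nat \<Rightarrow> 'a set \<Rightarrow> complex \<Rightarrow> bool" where
  "scalar_point k S \<equiv> eigenvalue_on (S \<times> {..<1}) (\<lambda>p q. complex_of_real (scalar_lap k p q))"

abbreviation scalar_radius :: "nat \<Rightarrow> 'a set \<Rightarrow> real" where
  "scalar_radius k \<equiv> matrix_weighted_tree.radius adj 1 (scalar_weight k)"

lemma matrix_weighted_tree_scalar: "matrix_weighted_tree V adj (scalar_weight k)"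
  by unfold_locales (simp add: W_edge)

lemma scalar_slice:
  "eigenvalue_on (S \<times> {k}) (\<lambda>p q. complex_of_real (lap p q)) \<mu> \<longleftrightarrow> scalar_point k S \<mu>"
proof -
  have bij: "bij_betw (\<lambda>p. (fst p, k)) (S \<times> {..<1::nat}) (S \<times> {k})"
    by (rule bij_betw_byWitness[of _ "\<lambda>p. (fst p, 0)"]) auto
  show ?thesis
    unfolding eigenvalue_on_reindex[OF bij]
    by (intro eigenvalue_on_cong) (simp add: lap_def matrix_weighted_tree.lap_def[OF matrix_weighted_tree_scalar])
qed

lemma slices_uncoupled:
  "(\<forall>p q. snd p < snd q \<longrightarrow> snd q < s \<longrightarrow> lap p q = 0) \<or>
   (\<forall>p q. snd p < snd q \<longrightarrow> snd q < s \<longrightarrow> lap q p = 0)"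
proof -
  have *: "lap p q = 0" if "\<And>x y. adj x y \<Longrightarrow> W x y (snd p) (snd q) = 0" for p q
    using that by (auto simp: lap_def intro!: sum.neutral)
  from triangular show ?thesis by (elim disjE) (blast intro: *)+
qed

lemma spectral_point_initial_slices:
  assumes "S \<subseteq> V" "n \<le> s"
  shows "eigenvalue_on (S \<times> {..<n}) (\<lambda>p q. complex_of_real (lap p q)) \<mu> \<longleftrightarrow>
    (\<exists>k<n. scalar_point k S \<mu>)"
  using assms(2)
proof (induction n)
  case 0
  then show ?case by (simp add: eigenvalue_on_def)
next
  case (Suc n)
  let ?a = "\<lambda>p q. complex_of_real (lap p q)"
  have fin: "finite (S \<times> {..<n})" "finite (S \<times> {n})" using assms finite_V finite_subset by auto
  have dis: "S \<times> {..<n} \<inter> S \<times> {n} = {}" "S \<times> {n} \<inter> S \<times> {..<n} = {}" by auto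
  have un: "S \<times> {..<Suc n} = S \<times> {..<n} \<union> S \<times> {n}" by (auto simp: less_Suc_eq)
  have "eigenvalue_on (S \<times> {..<Suc n}) ?a \<mu> \<longleftrightarrow>
      eigenvalue_on (S \<times> {..<n}) ?a \<mu> \<or> eigenvalue_on (S \<times> {n}) ?a \<mu>"
    using slices_uncoupled
  proof
    assume "\<forall>p q. snd p < snd q \<longrightarrow> snd q < s \<longrightarrow> lap p q = 0"
    then show ?thesis unfolding un
      using Suc.prems by (intro eigenvalue_on_block_triangular[OF fin dis(1)]) auto
  next
    assume *: "\<forall>p q. snd p < snd q \<longrightarrow> snd q < s \<longrightarrow> lap q p = 0"
    have "eigenvalue_on (S \<times> {n} \<union> S \<times> {..<n}) ?a \<mu> \<longleftrightarrow>
      eigenvalue_on (S \<times> {n}) ?a \<mu> \<or> eigenvalue_on (S \<times> {..<n}) ?a \<mu>"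
      using Suc.prems * by (intro eigenvalue_on_block_triangular[OF fin(2,1) dis(2)]) auto
    then show ?thesis unfolding un by (auto simp: Un_commute)
  qed
  then show ?case using Suc by (auto simp: scalar_slice less_Suc_eq)
qed

lemma spectral_point_iff_scalar:
  "S \<subseteq> V \<Longrightarrow> spectral_point S \<mu> \<longleftrightarrow> (\<exists>k<s. scalar_point k S \<mu>)"
  using spectral_point_initial_slices[of S s] by simp

lemma zero_not_spectral_point:
  assumes "S \<subset> V"
  shows "\<not> spectral_point S 0"
  using spectral_point_iff_scalar[of S 0] assms pd_weighted_tree.zero_not_spectral_point[OF scalar_pd assms]
  by auto

text \<open>The value of \<open>S\<close> is attained in some scalar slice \<open>k\<close>, whose value grows strictly on passing to
  \<open>T\<close> and is at most the value of \<open>T\<close>.\<close>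

lemma radius_strict_mono:
  assumes ST: "connected_set S" "connected_set T" "S \<noteq> {}" "S \<subset> T" "T \<subset> V"
  shows "radius S < radius T"
proof -
  have SV: "S \<subseteq> V" "T \<subseteq> V" "T \<noteq> {}" using ST by auto
  have fin: "finite (blocks S)" "blocks S \<noteq> {}" "finite (blocks T)"
    using finite_blocks SV ST s_pos by (auto simp: lessThan_empty_iff)
  obtain \<mu> where \<mu>: "spectral_point S \<mu>" "radius S = inverse (norm \<mu>)"
    unfolding radius_def by (rule inverse_radius_attained[OF fin(1,2)])
  then obtain k where k: "k < s" "scalar_point k S \<mu>" using spectral_point_iff_scalar SV by blast
  have "finite S" "finite T" using SV finite_subset[OF _ finite_V] by blast+
  then have fin1: "finite (S \<times> {..<1::nat})" "finite (T \<times> {..<1::nat})" "T \<times> {..<1::nat} \<noteq> {}"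
    using SV(3) by (auto simp: lessThan_empty_iff)
  note radius1 = matrix_weighted_tree.radius_def[OF matrix_weighted_tree_scalar]
  obtain \<nu> where \<nu>: "scalar_point k T \<nu>" "scalar_radius k T = inverse (norm \<nu>)"
    unfolding radius1 by (rule inverse_radius_attained[OF fin1(2,3)])
  have "radius S \<le> scalar_radius k S"
    unfolding \<mu>(2) radius1 by (rule inverse_radius_ge[OF fin1(1) k(2)])
  also have "\<dots> < scalar_radius k T"
    by (rule pd_weighted_tree.radius_strict_mono[OF scalar_pd[OF k(1)] ST])
  also have "\<dots> \<le> radius T"
    unfolding \<nu>(2) radius_def
    by (rule inverse_radius_ge[OF fin(3)]) (use spectral_point_iff_scalar[OF SV(2)] k(1) \<nu>(1) in blast)
  finally show ?thesis .
qed

end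

section \<open>Trees of the graph library\<close>

lemma arcs_ends_induce:
  "(x, y) \<in> arcs_ends (G \<restriction> S) \<longleftrightarrow> x \<in> S \<and> y \<in> S \<and> x \<rightarrow>\<^bsub>G\<^esub> y"
  by (auto simp: arcs_ends_conv)

lemma reachable_induce_iff:
  "x \<rightarrow>\<^sup>*\<^bsub>G \<restriction> S\<^esub> y \<longleftrightarrow> x \<in> S \<and> (\<lambda>a b. a \<in> S \<and> b \<in> S \<and> a \<rightarrow>\<^bsub>G\<^esub> b)\<^sup>*\<^sup>* x y"
proof
  assume "x \<rightarrow>\<^sup>*\<^bsub>G \<restriction> S\<^esub> y"
  then have "(x, y) \<in> rtrancl_on S (arcs_ends (G \<restriction> S))" by (simp add: reachable_def)
  then show "x \<in> S \<and> (\<lambda>a b. a \<in> S \<and> b \<in> S \<and> a \<rightarrow>\<^bsub>G\<^esub> b)\<^sup>*\<^sup>* x y"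
  proof (induction rule: rtrancl_on_induct)
    case (step y z)
    then have "y \<in> S \<and> z \<in> S \<and> y \<rightarrow>\<^bsub>G\<^esub> z" by (simp add: arcs_ends_induce)
    with step.IH show ?case by (auto intro: rtranclp.rtrancl_into_rtrancl)
  qed simp
next
  assume *: "x \<in> S \<and> (\<lambda>a b. a \<in> S \<and> b \<in> S \<and> a \<rightarrow>\<^bsub>G\<^esub> b)\<^sup>*\<^sup>* x y"
  then have "(\<lambda>a b. a \<in> S \<and> b \<in> S \<and> a \<rightarrow>\<^bsub>G\<^esub> b)\<^sup>*\<^sup>* x y" by simp
  then have "(x, y) \<in> rtrancl_on S (arcs_ends (G \<restriction> S))"
  proof (induction rule: rtranclp_induct)
    case (step y z)
    then show ?case by (intro rtrancl_on_into_rtrancl_on[OF step.IH]) (auto simp: arcs_ends_induce)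
  qed (use * in simp)
  then show "x \<rightarrow>\<^sup>*\<^bsub>G \<restriction> S\<^esub> y" by (simp add: reachable_def)
qed

lemma (in wf_digraph) del_vert_eq_induce: "del_vert v = G \<restriction> (verts G - {v})"
  by (auto simp: del_vert_def induce_subgraph_def)

lemma (in wf_digraph) induce_verts: "G \<restriction> verts G = G"
  by (rule pre_digraph.equality) (auto simp: induce_subgraph_def)

text \<open>A path from \<open>c\<close> to \<open>c'\<close> inside \<open>C\<close> is closed by the two arcs at \<open>w\<close>. It has at least one arc,
  which lifts the cycle above the length 2 of a back-and-forth walk.\<close>

lemma (in graph) cycle_through_connected_set:
  assumes con: "\<And>x y. x \<in> C \<Longrightarrow> y \<in> C \<Longrightarrow> (\<lambda>a b. a \<in> C \<and> b \<in> C \<and> a \<rightarrow>\<^bsub>G\<^esub> b)\<^sup>*\<^sup>* x y"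
    and C: "C \<subseteq> verts G" "w \<notin> C" "c \<in> C" "c' \<in> C" "c \<noteq> c'"
    and w: "w \<rightarrow>\<^bsub>G\<^esub> c" "c' \<rightarrow>\<^bsub>G\<^esub> w"
  shows "\<exists>p. cycle p \<and> 3 \<le> length p"
proof -
  let ?H = "G \<restriction> C"
  interpret H: wf_digraph ?H by (rule wellformed_induce_subgraph)
  have "c \<rightarrow>\<^sup>*\<^bsub>?H\<^esub> c'" using con C by (simp add: reachable_induce_iff)
  then obtain p where p: "H.apath c p c'"
    using H.reachable_apath by blast
  have sub: "subgraph ?H G" by (rule subgraph_induce_subgraphI[OF C(1)])
  have pG: "apath c p c'" by (rule subgraph_apath_imp_apath[OF p sub])
  have awH: "H.awalk c p c'" using p by (rule H.awalkI_apath)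
  then have "set (H.awalk_verts c p) \<subseteq> C"
    using H.awalk_verts_in_verts[of c p] by (auto simp: H.awalk_def)
  then have vC: "set (awalk_verts c p) \<subseteq> C" by (simp add: awalk_verts_induce)
  have aw: "awalk c p c'" using pG by (rule awalkI_apath)
  have ne: "p \<noteq> []" using aw C(5) by auto
  obtain e1 where e1: "e1 \<in> arcs G" "tail G e1 = w" "head G e1 = c" using w(1) by (auto simp: arcs_ends_conv)
  obtain e2 where e2: "e2 \<in> arcs G" "tail G e2 = c'" "head G e2 = w" using w(2) by (auto simp: arcs_ends_conv)
  have aw2: "awalk c (p @ [e2]) w"
    by (rule awalk_appendI[OF aw]) (use e2 arc_implies_awalk[of e2] in auto)
  have "awalk w (e1 # p @ [e2]) w" using e1 aw2 by (simp add: awalk_Cons_iff del: awalk_append_iff)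
  moreover have "awalk_verts c (p @ [e2]) = awalk_verts c p @ [w]"
    unfolding awalk_verts_append[OF aw2] using e2 by simp
  then have "tl (awalk_verts w (e1 # p @ [e2])) = awalk_verts c p @ [w]" using e1 by simp
  then have "distinct (tl (awalk_verts w (e1 # p @ [e2])))"
    using pG vC C(2) by (auto simp: apath_def)
  ultimately have "cycle (e1 # p @ [e2])" unfolding cycle_def by blast
  moreover have "3 \<le> length (e1 # p @ [e2])" using ne by (cases p) auto
  ultimately show ?thesis by blast
qed

lemma abstract_tree_of_finite_tree:
  assumes "finite_tree G"
  shows "abstract_tree (verts G) (\<lambda>x y. x \<rightarrow>\<^bsub>G\<^esub> y)"
proof -
  have g: "graph G" and con: "Digraph_Component.connected G"
    and cyc: "\<And>p. pre_digraph.cycle G p \<Longrightarrow> length p \<le> 2"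
    using assms by (auto simp: finite_tree_def)
  interpret graph G by (rule g)
  have sym: "y \<rightarrow>\<^bsub>G\<^esub> x" if "x \<rightarrow>\<^bsub>G\<^esub> y" for x y
    using that graph_symmetric by blast
  show ?thesis
  proof
    show "finite (verts G)" by simp
    show "y \<rightarrow>\<^bsub>G\<^esub> x" if "x \<rightarrow>\<^bsub>G\<^esub> y" for x y by (rule sym[OF that])
    show "\<not> x \<rightarrow>\<^bsub>G\<^esub> x" for x using adj_not_same by blast
    show "x \<in> verts G" if "x \<rightarrow>\<^bsub>G\<^esub> y" for x y using that adj_in_verts by blast
    show "(\<lambda>a b. a \<in> verts G \<and> b \<in> verts G \<and> a \<rightarrow>\<^bsub>G\<^esub> b)\<^sup>*\<^sup>* x y" if "x \<in> verts G" "y \<in> verts G" for x y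
    proof -
      have "strongly_connected G"
        by (rule symmetric_connected_imp_strongly_connected[OF sym_arcs con])
      then have "x \<rightarrow>\<^sup>*\<^bsub>G\<^esub> y" using that by (auto simp: strongly_connected_def)
      then show ?thesis using reachable_induce_iff[where G=G and S="verts G" and x=x and y=y] by (simp add: induce_verts)
    qed
    show "c = c'" if h: "\<And>x y. x \<in> C \<Longrightarrow> y \<in> C \<Longrightarrow> (\<lambda>a b. a \<in> C \<and> b \<in> C \<and> a \<rightarrow>\<^bsub>G\<^esub> b)\<^sup>*\<^sup>* x y"
      "C \<subseteq> verts G" "w \<notin> C" "c \<in> C" "c' \<in> C" "w \<rightarrow>\<^bsub>G\<^esub> c" "w \<rightarrow>\<^bsub>G\<^esub> c'" for C w c c'
    proof (rule ccontr)
      assume "c \<noteq> c'"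
      then obtain p where "cycle p" "3 \<le> length p"
        using cycle_through_connected_set[OF h(1-5) _ h(6) sym[OF h(7)]] by blast
      then show False using cyc by fastforce
    qed
  qed
qed

lemma adjacent_iff_edge:
  assumes "finite_tree G"
  shows "{x, y} \<in> edges G \<longleftrightarrow> x \<rightarrow>\<^bsub>G\<^esub> y"
proof -
  interpret abstract_tree "verts G" "\<lambda>x y. x \<rightarrow>\<^bsub>G\<^esub> y" by (rule abstract_tree_of_finite_tree[OF assms])
  show ?thesis by (auto simp: edges_def doubleton_eq_iff dest: adj_sym)
qed

lemma branch_of_eq_component:
  assumes G: "finite_tree G" and u: "u \<in> verts G - {v}"
  shows "branch_of G v u = abstract_tree.component (\<lambda>x y. x \<rightarrow>\<^bsub>G\<^esub> y) (verts G - {v}) u"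
proof -
  interpret graph G using G by (simp add: finite_tree_def)
  interpret T: abstract_tree "verts G" "\<lambda>x y. x \<rightarrow>\<^bsub>G\<^esub> y" by (rule abstract_tree_of_finite_tree[OF G])
  have "x \<rightarrow>\<^sup>*\<^bsub>G \<restriction> (verts G - {v})\<^esub> y \<longleftrightarrow> x \<in> verts G - {v} \<and> T.walk_in (verts G - {v}) x y" for x y
    by (simp add: reachable_induce_iff T.walk_in_def)
  moreover have "T.walk_in (verts G - {v}) u y \<Longrightarrow> y \<in> verts G - {v}" for y
    unfolding T.walk_in_def by (induction rule: rtranclp_induct) (use u in auto)
  ultimately show ?thesis
    using u unfolding branch_of_def del_vert_eq_induce pre_digraph.scc_of_def T.component_def
    by (auto dest: T.walk_in_sym)
qed

lemma branches_eq:
  assumes G: "finite_tree G"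
  shows "branches G v = abstract_tree.branches_at (verts G) (\<lambda>x y. x \<rightarrow>\<^bsub>G\<^esub> y) v"
proof -
  interpret graph G using G by (simp add: finite_tree_def)
  interpret T: abstract_tree "verts G" "\<lambda>x y. x \<rightarrow>\<^bsub>G\<^esub> y" by (rule abstract_tree_of_finite_tree[OF G])
  interpret D: wf_digraph "del_vert v" by (rule wf_digraph_del_vert)
  have "branches G v = D.scc_of ` (verts G - {v})"
    by (simp add: branches_def D.sccs_verts_conv_scc_of verts_del_vert)
  also have "\<dots> = T.branch v ` (verts G - {v})"
    using branch_of_eq_component[OF G, of _ v] by (intro image_cong) (auto simp: branch_of_def)
  finally show ?thesis by (simp add: T.branches_at_def)
qed

section \<open>Positions in block matrices\<close>

lemma pick_enumeration:
  fixes h :: "nat \<Rightarrow> nat"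
  assumes "strict_mono h" "h ` {..<n} = I" "p < n"
  shows "pick I p = h p"
proof -
  have "{a \<in> I. a < h p} = h ` {..<p}"
    using assms by (auto simp: strict_mono_less)
  moreover have "inj_on h {..<p}"
    using assms(1) by (meson inj_on_subset strict_mono_imp_inj_on subset_UNIV)
  ultimately have "card {a \<in> I. a < h p} = p" by (simp add: card_image)
  moreover have "h p \<in> I" using assms by auto
  ultimately show ?thesis using pick_card_in_set by metis
qed

lemma bij_betw_block_positions:
  assumes "distinct ws"
  shows "bij_betw (\<lambda>p. (ws ! (p div s), p mod s)) (block_positions s ws B) ((B \<inter> set ws) \<times> {..<s})"
proof (cases "s = 0")
  case False
  then have s: "0 < s" by simp
  have lt: "p div s < length ws" if "p < length ws * s" for p
    using that by (simp add: less_mult_imp_div_less)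
  show ?thesis
  proof (rule bij_betw_imageI)
    show "inj_on (\<lambda>p. (ws ! (p div s), p mod s)) (block_positions s ws B)"
    proof (rule inj_onI)
      fix p q
      assume pq: "p \<in> block_positions s ws B" "q \<in> block_positions s ws B"
        and eq: "(ws ! (p div s), p mod s) = (ws ! (q div s), q mod s)"
      then have "p div s = q div s"
        using lt nth_eq_iff_index_eq[OF assms] by (auto simp: block_positions_def)
      then show "p = q" using eq by (metis div_mult_mod_eq prod.inject)
    qed
    show "(\<lambda>p. (ws ! (p div s), p mod s)) ` block_positions s ws B = (B \<inter> set ws) \<times> {..<s}"
    proof (intro equalityI subsetI)
      fix x assume "x \<in> (\<lambda>p. (ws ! (p div s), p mod s)) ` block_positions s ws B"
      then show "x \<in> (B \<inter> set ws) \<times> {..<s}" using lt s by (auto simp: block_positions_def)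
    next
      fix x assume "x \<in> (B \<inter> set ws) \<times> {..<s}"
      then obtain k i where x: "x = (ws ! k, i)" "k < length ws" "ws ! k \<in> B" "i < s"
        by (cases x) (auto simp: in_set_conv_nth)
      have "k * s + i < Suc k * s" using x by simp
      also have "\<dots> \<le> length ws * s" using x by (intro mult_le_mono1) simp
      finally have "k * s + i \<in> block_positions s ws B"
        using x s by (simp add: block_positions_def)
      moreover have "(ws ! ((k * s + i) div s), (k * s + i) mod s) = x" using x s by simp
      ultimately show "x \<in> (\<lambda>p. (ws ! (p div s), p mod s)) ` block_positions s ws B"
        by (metis (no_types, lifting) image_eqI)
    qed
  qed
qed (simp add: block_positions_def bij_betw_def)

lemma block_positions_all: "block_positions s ws (set ws) = {..<length ws * s}"
  by (auto simp: block_positions_def less_mult_imp_div_less)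

lemma laplacian_carrier: "laplacian G s W ws \<in> carrier_mat (length ws * s) (length ws * s)"
  by (simp add: laplacian_def)

text \<open>Deleting the block row and column of \<open>v\<close> skips the \<open>s\<close> consecutive positions of \<open>v\<close>. The map \<open>h\<close>
  is the increasing enumeration of the remaining positions.\<close>

lemma reduced_laplacian_eq:
  assumes dist: "distinct vs" and v: "v \<in> set vs" and s: "0 < s"
  shows "reduced_laplacian G s W vs v = laplacian G s W (removeAll v vs)"
proof -
  obtain as bs where vs: "vs = as @ v # bs" using split_list[OF v] by blast
  have notin: "v \<notin> set as" "v \<notin> set bs" using dist vs by auto
  then have ws: "removeAll v vs = as @ bs" by (simp add: vs removeAll_id)
  define k where "k = length as"
  define n where "n = length (as @ bs) * s"
  define I where "I = block_positions s vs (- {v})"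
  define h where "h p = (if p < k * s then p else p + s)" for p
  have len: "length vs * s = n + s" by (simp add: vs n_def algebra_simps)
  have kn: "k * s \<le> n" by (simp add: k_def n_def)
  have mono: "strict_mono h" by (rule strict_monoI) (auto simp: h_def)
  have div_h: "h p div s = (if p div s < k then p div s else Suc (p div s))" for p
  proof -
    have "p < k * s \<longleftrightarrow> p div s < k" using s by (simp add: div_less_iff_less_mult)
    then show ?thesis using s by (simp add: h_def)
  qed
  have mod_h: "h p mod s = p mod s" for p by (simp add: h_def)
  have nth_h: "vs ! (h p div s) = (as @ bs) ! (p div s)" for p
    unfolding div_h by (auto simp: vs nth_append k_def Suc_diff_le)
  have image: "h ` {..<n} = I"
  proof (intro equalityI subsetI)
    fix a assume "a \<in> h ` {..<n}"
    then obtain p where p: "p < n" "a = h p" by auto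
    have "p div s < length (as @ bs)" using p s by (simp add: n_def less_mult_imp_div_less)
    then have "(as @ bs) ! (p div s) \<in> set (as @ bs)" by (rule nth_mem)
    then have "vs ! (a div s) \<noteq> v" using notin nth_h[of p] p by auto
    moreover have "a < length vs * s" using p len by (auto simp: h_def)
    ultimately show "a \<in> I" by (simp add: I_def block_positions_def)
  next
    fix a assume "a \<in> I"
    then have a: "a < n + s" "vs ! (a div s) \<noteq> v" by (auto simp: I_def block_positions_def len)
    then have ne: "a div s \<noteq> k" by (auto simp: vs nth_append k_def)
    show "a \<in> h ` {..<n}"
    proof (cases "a < k * s")
      case True
      then have "h a = a" "a < n" using kn by (auto simp: h_def)
      then show ?thesis by (metis image_eqI lessThan_iff)
    next
      case False
      then have "k \<le> a div s" using s by (simp add: less_eq_div_iff_mult_less_eq)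
      then have "Suc k * s \<le> a" using ne s by (simp add: less_eq_div_iff_mult_less_eq[symmetric] Suc_le_eq del: mult_Suc)
      then have "h (a - s) = a" "a - s < n" using a by (auto simp: h_def)
      then show ?thesis by (metis image_eqI lessThan_iff)
    qed
  qed
  have pick: "pick I p = h p" if "p < n" for p by (rule pick_enumeration[OF mono image that])
  have hn: "h p < n + s" if "p < n" for p using that by (auto simp: h_def)
  have "inj_on h {..<n}" using mono by (meson inj_on_subset strict_mono_imp_inj_on subset_UNIV)
  then have "card I = n" unfolding image[symmetric] by (simp add: card_image)
  moreover have "I \<subseteq> {..<n + s}" using hn unfolding image[symmetric] by auto
  moreover have "laplacian G s W vs \<in> carrier_mat (n + s) (n + s)"
    using laplacian_carrier[of G s W vs] len by simp
  ultimately have sub: "submatrix (laplacian G s W vs) I I \<in> carrier_mat n n"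
    "\<And>p q. p < n \<Longrightarrow> q < n \<Longrightarrow>
      submatrix (laplacian G s W vs) I I $$ (p, q) = laplacian G s W vs $$ (h p, h q)"
    using submatrix_carrier[of "laplacian G s W vs" "n + s" I] pick by auto
  have "submatrix (laplacian G s W vs) I I = laplacian G s W (as @ bs)"
  proof (rule eq_matI)
    fix p q assume "p < dim_row (laplacian G s W (as @ bs))" "q < dim_col (laplacian G s W (as @ bs))"
    then have pq: "p < n" "q < n" by (auto simp: laplacian_def n_def)
    then show "submatrix (laplacian G s W vs) I I $$ (p, q) = laplacian G s W (as @ bs) $$ (p, q)"
      unfolding sub(2)[OF pq] unfolding laplacian_def
      using hn[OF pq(1)] hn[OF pq(2)] len by (simp add: nth_h mod_h n_def[symmetric] del: length_append)
  qed (use sub(1) in \<open>auto simp: laplacian_def n_def\<close>)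
  then show ?thesis by (simp add: reduced_laplacian_def principal_blocks_def I_def ws)
qed

lemma inverse_radius_reindex:
  assumes "bij_betw h J I" "\<And>p q. p \<in> J \<Longrightarrow> q \<in> J \<Longrightarrow> b p q = a (h p) (h q)"
  shows "inverse_radius J b = inverse_radius I a"
proof -
  have "{\<mu>. eigenvalue_on J b \<mu>} = {\<mu>. eigenvalue_on I a \<mu>}"
    unfolding eigenvalue_on_reindex[OF assms(1)]
    by (rule Collect_cong, rule eigenvalue_on_cong) (rule assms(2))
  then show ?thesis unfolding inverse_radius_def by (simp only:)
qed

section \<open>Perron branches of weighted trees\<close>

locale weighted_tree_graph =
  fixes G :: "('v, 'e) pre_digraph" and s :: nat and W :: "'v set \<Rightarrow> real mat" and vs :: "'v list"
  assumes tree: "finite_tree G"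
    and two_verts: "2 \<le> card (verts G)"
    and s_ge_1: "1 \<le> s"
    and admissible: "admissible_weights G s W"
    and distinct_vs: "distinct vs" and set_vs: "set vs = verts G"

sublocale weighted_tree_graph \<subseteq>
  matrix_weighted_tree "verts G" "\<lambda>x y. x \<rightarrow>\<^bsub>G\<^esub> y" s "\<lambda>x y i j. W {x, y} $$ (i, j)"
proof -
  interpret abstract_tree "verts G" "\<lambda>x y. x \<rightarrow>\<^bsub>G\<^esub> y" by (rule abstract_tree_of_finite_tree[OF tree])
  show "matrix_weighted_tree (verts G) (\<lambda>x y. x \<rightarrow>\<^bsub>G\<^esub> y) (\<lambda>x y i j. W {x, y} $$ (i, j))"
    by unfold_locales (simp add: insert_commute)
qed

context weighted_tree_graph
begin

lemma edge_iff: "{x, y} \<in> edges G \<longleftrightarrow> x \<rightarrow>\<^bsub>G\<^esub> y"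
  by (rule adjacent_iff_edge[OF tree])

lemma weight_carrier: "e \<in> edges G \<Longrightarrow> W e \<in> carrier_mat s s"
  using admissible
  by (auto simp: admissible_weights_def positive_definite_def lower_triangular_pos_def upper_triangular_pos_def)

lemma laplacian_block_eq_lap:
  assumes "i < s" "j < s"
  shows "laplacian_block G s W x y $$ (i, j) = lap (x, i) (y, j)"
proof (cases "x = y")
  case True
  have "{e \<in> edges G. y \<in> e} = (\<lambda>u. {y, u}) ` {u. y \<rightarrow>\<^bsub>G\<^esub> u}"
  proof (intro equalityI subsetI)
    fix e assume "e \<in> {e \<in> edges G. y \<in> e}"
    then obtain a b where ab: "e = {a, b}" "a \<rightarrow>\<^bsub>G\<^esub> b" "y \<in> {a, b}" by (auto simp: edges_def)
    then have "e = {y, b} \<and> y \<rightarrow>\<^bsub>G\<^esub> b \<or> e = {y, a} \<and> y \<rightarrow>\<^bsub>G\<^esub> a"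
      using adj_sym by auto
    then show "e \<in> (\<lambda>u. {y, u}) ` {u. y \<rightarrow>\<^bsub>G\<^esub> u}" by auto
  qed (auto simp: edge_iff)
  moreover have "inj_on (\<lambda>u. {y, u}) {u. y \<rightarrow>\<^bsub>G\<^esub> u}"
    using adj_irrefl by (auto simp: inj_on_def doubleton_eq_iff)
  ultimately have "(\<Sum>e\<in>{e \<in> edges G. y \<in> e}. W e $$ (i, j)) = (\<Sum>u\<in>{u. y \<rightarrow>\<^bsub>G\<^esub> u}. W {y, u} $$ (i, j))"
    by (simp add: sum.reindex)
  then show ?thesis using True assms by (simp add: laplacian_block_def lap_def)
next
  case False
  then show ?thesis
    using assms weight_carrier[of "{x, y}"] by (auto simp: laplacian_block_def lap_def edge_iff)
qed

text \<open>The three classes of weights meet here; everything after it is uniform in them.\<close>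

lemma zero_not_spectral_point_and_radius_strict_mono:
  "(\<forall>S. S \<subset> verts G \<longrightarrow> \<not> spectral_point S 0) \<and>
   (\<forall>S T. connected_set S \<longrightarrow> connected_set T \<longrightarrow> S \<noteq> {} \<longrightarrow> S \<subset> T \<longrightarrow> T \<subset> verts G \<longrightarrow> radius S < radius T)"
proof -
  consider (pd) "\<forall>e\<in>edges G. positive_definite s (W e)"
    | (lower) "\<forall>e\<in>edges G. lower_triangular_pos s (W e)"
    | (upper) "\<forall>e\<in>edges G. upper_triangular_pos s (W e)"
    using admissible by (auto simp: admissible_weights_def)
  then show ?thesis
  proof cases
    case pd
    interpret pd_weighted_tree "verts G" "\<lambda>x y. x \<rightarrow>\<^bsub>G\<^esub> y" s "\<lambda>x y i j. W {x, y} $$ (i, j)"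
    proof unfold_locales
      show "1 \<le> s" by (rule s_ge_1)
      fix x y assume xy: "x \<rightarrow>\<^bsub>G\<^esub> y"
      then have P: "positive_definite s (W {x, y})" using pd by (simp add: edge_iff)
      then have A: "W {x, y} \<in> carrier_mat s s" "transpose_mat (W {x, y}) = W {x, y}"
        by (auto simp: positive_definite_def)
      show "W {x, y} $$ (i, j) = W {x, y} $$ (j, i)" if "i < s" "j < s" for i j
        using A(1) that by (subst A(2)[symmetric]) simp
      fix i and \<xi> :: "nat \<Rightarrow> real" assume i: "i < s" "\<xi> i \<noteq> 0"
      have "vec s \<xi> \<noteq> 0\<^sub>v s"
      proof
        assume "vec s \<xi> = 0\<^sub>v s"
        then have "vec s \<xi> $ i = 0\<^sub>v s $ i" by simp
        then show False using i by simp
      qed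
      then have "0 < vec s \<xi> \<bullet> (W {x, y} *\<^sub>v vec s \<xi>)"
        using P by (simp add: positive_definite_def)
      also have "\<dots> = (\<Sum>i<s. \<xi> i * (\<Sum>j<s. W {x, y} $$ (i, j) * \<xi> j))"
        using A(1) by (simp add: scalar_prod_def atLeast0LessThan)
      finally show "0 < (\<Sum>i<s. \<Sum>j<s. \<xi> i * W {x, y} $$ (i, j) * \<xi> j)"
        by (simp add: sum_distrib_left mult.assoc)
    qed
    show ?thesis using zero_not_spectral_point radius_strict_mono by blast
  next
    case lower
    interpret triangular_weighted_tree "verts G" "\<lambda>x y. x \<rightarrow>\<^bsub>G\<^esub> y" s "\<lambda>x y i j. W {x, y} $$ (i, j)"
      by unfold_locales (use lower s_ge_1 in \<open>auto simp: edge_iff[symmetric] lower_triangular_pos_def\<close>)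
    show ?thesis using zero_not_spectral_point radius_strict_mono by blast
  next
    case upper
    interpret triangular_weighted_tree "verts G" "\<lambda>x y. x \<rightarrow>\<^bsub>G\<^esub> y" s "\<lambda>x y i j. W {x, y} $$ (i, j)"
    proof unfold_locales
      have "W {x, y} $$ (j, i) = 0" if "x \<rightarrow>\<^bsub>G\<^esub> y" "i < j" "j < s" for x y i j
        using upper that by (auto simp: edge_iff[symmetric] upper_triangular_pos_def upper_triangular_def)
      then show "(\<forall>x y i j. x \<rightarrow>\<^bsub>G\<^esub> y \<longrightarrow> i < j \<longrightarrow> j < s \<longrightarrow> W {x, y} $$ (i, j) = 0) \<or>
        (\<forall>x y i j. x \<rightarrow>\<^bsub>G\<^esub> y \<longrightarrow> i < j \<longrightarrow> j < s \<longrightarrow> W {x, y} $$ (j, i) = 0)" by blast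
    qed (use upper s_ge_1 in \<open>auto simp: edge_iff[symmetric] upper_triangular_pos_def\<close>)
    show ?thesis using zero_not_spectral_point radius_strict_mono by blast
  qed
qed

end

sublocale weighted_tree_graph \<subseteq> valued_tree "verts G" "\<lambda>x y. x \<rightarrow>\<^bsub>G\<^esub> y" radius
  by unfold_locales (use two_verts zero_not_spectral_point_and_radius_strict_mono in auto)

context weighted_tree_graph
begin

lemma lap_between_branches:
  assumes "B \<in> branches_at v" "p \<in> blocks B" "q \<in> blocks (verts G - {v}) - blocks B"
  shows "lap p q = 0" "lap q p = 0"
proof -
  have B: "B = branch v (fst p)" using branches_at_eqI assms by auto
  have "fst q \<notin> B" using assms by auto
  then have "\<not> fst p \<rightarrow>\<^bsub>G\<^esub> fst q" "fst p \<noteq> fst q"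
    using component_step[of "fst p" "verts G - {v}" "fst p" "fst q"] assms B by auto
  then show "lap p q = 0" "lap q p = 0" using adj_sym by (auto simp: lap_def)
qed

text \<open>Both matrices are diagonal blocks of \<open>M\<^sub>v\<close>, the first being all of it, and the reduced Laplacian
  couples neither of them with the rest.\<close>

lemma spectral_radii:
  assumes v: "v \<in> verts G"
  shows "real_spectral_radius (inverse_reduced_laplacian G s W vs v) = radius (verts G - {v})"
    and "B \<in> branches_at v \<Longrightarrow>
      real_spectral_radius (bottleneck_matrix G s W vs v B) = radius B"
proof -
  define ws where "ws = removeAll v vs"
  define n where "n = length ws * s"
  define R where "R = laplacian G s W ws"
  define h where "h p = (ws ! (p div s), p mod s)" for p
  have s: "0 < s" using s_ge_1 by simp
  have ws: "distinct ws" "set ws = verts G - {v}"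
    using distinct_vs set_vs by (auto simp: ws_def distinct_removeAll)
  have R: "R \<in> carrier_mat n n" by (simp add: R_def n_def laplacian_carrier)
  have red: "reduced_laplacian G s W vs v = R"
    unfolding R_def ws_def by (rule reduced_laplacian_eq[OF distinct_vs _ s]) (use set_vs v in simp)
  have entry: "R $$ (p, q) = lap (h p) (h q)" if "p < n" "q < n" for p q
    using that s by (simp add: R_def laplacian_def n_def h_def laplacian_block_eq_lap)
  have bij: "bij_betw h (block_positions s ws B) (blocks B)" if "B \<subseteq> verts G - {v}" for B
  proof -
    have "B \<inter> set ws = B" using that ws by auto
    then show ?thesis using bij_betw_block_positions[OF ws(1), of s B] by (simp add: h_def[abs_def])
  qed
  have sub: "block_positions s ws B \<subseteq> {..<n}" for B by (auto simp: block_positions_def n_def)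
  have all: "block_positions s ws (verts G - {v}) = {..<n}"
    using block_positions_all[of s ws] ws by (simp add: n_def)
  have rad: "inverse_radius (block_positions s ws B) (\<lambda>p q. complex_of_real (R $$ (p, q))) = radius B"
    if "B \<subseteq> verts G - {v}" for B
    unfolding radius_def
    by (rule inverse_radius_reindex[OF bij[OF that]]) (use entry sub[of B] in auto)
  have "\<not> eigenvalue_on {..<n} (\<lambda>p q. complex_of_real (R $$ (p, q))) 0"
  proof
    assume "eigenvalue_on {..<n} (\<lambda>p q. complex_of_real (R $$ (p, q))) 0"
    then have "eigenvalue_on {..<n} (\<lambda>p q. complex_of_real (lap (h p) (h q))) 0"
      by (subst eigenvalue_on_cong[of _ _ "\<lambda>p q. complex_of_real (R $$ (p, q))"]) (auto simp: entry)
    then have "spectral_point (verts G - {v}) 0"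
      using eigenvalue_on_reindex[OF bij[of "verts G - {v}"]] all by auto
    then show False using zero_not_spectral_point_and_radius_strict_mono v by auto
  qed
  then obtain N where N: "mat_inverse R = Some N" "N \<in> carrier_mat n n" "R * N = 1\<^sub>m n" "N * R = 1\<^sub>m n"
    by (rule mat_inverse_exists[OF R])
  have inv: "inverse_reduced_laplacian G s W vs v = N"
    by (simp add: inverse_reduced_laplacian_def red N)
  show "real_spectral_radius (inverse_reduced_laplacian G s W vs v) = radius (verts G - {v})"
    unfolding inv real_spectral_radius_whole[OF N(2)] rad[OF order.refl, symmetric] all
    by (rule eigenvalues_of_inverse_block[OF R N(2-4)]) auto
  assume B: "B \<in> branches_at v"
  then have BV: "B \<subseteq> verts G - {v}" by (rule branches_at_props)
  have dec: "R $$ (p, q) = 0 \<and> R $$ (q, p) = 0"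
    if "p \<in> block_positions s ws B" "q \<in> {..<n} - block_positions s ws B" for p q
  proof -
    have "p < n" "q < n" using that sub[of B] by auto
    moreover have "h p \<in> blocks B" using bij_betwE[OF bij[OF BV]] that by auto
    moreover have "h q \<in> blocks (verts G - {v})"
      using bij_betwE[OF bij[OF order.refl]] that all by auto
    moreover have "h q \<notin> blocks B"
      using that by (auto simp: h_def block_positions_def n_def)
    ultimately show ?thesis using entry lap_between_branches[OF B] by simp
  qed
  show "real_spectral_radius (bottleneck_matrix G s W vs v B) = radius B"
    unfolding bottleneck_matrix_def inv principal_blocks_def ws_def[symmetric]
      real_spectral_radius_submatrix[OF N(2) sub] rad[OF BV, symmetric]
    by (rule eigenvalues_of_inverse_block[OF R N(2-4) sub dec])
qed

text \<open>The spectrum of the reduced Laplacian is the union of the spectra of the branches, so its value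
  is the largest among the branches.\<close>

lemma radius_of_all_branches:
  assumes v: "v \<in> verts G"
  shows "B \<in> branches_at v \<Longrightarrow> radius B \<le> radius (verts G - {v})"
    and "\<exists>B\<in>branches_at v. radius (verts G - {v}) = radius B"
proof -
  let ?U = "verts G - {v}" and ?a = "\<lambda>p q. complex_of_real (lap p q)"
  have un: "blocks ?U = \<Union> (blocks ` branches_at v)"
    using branches_at_props(3) component_self[of _ ?U] by (fastforce simp: branches_at_def)
  have finU: "finite (blocks ?U)" by (rule finite_blocks) blast
  have uncoupled: "?a p q = 0 \<and> ?a q p = 0"
    if J: "J \<in> blocks ` branches_at v" "p \<in> J" "q \<in> blocks ?U - J" for J p q
  proof -
    obtain B where "B \<in> branches_at v" "J = blocks B" using J(1) by blast
    then show ?thesis using lap_between_branches[of B v p q] J(2,3) by simp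
  qed
  have dec: "spectral_point ?U \<mu> \<longleftrightarrow> (\<exists>B\<in>branches_at v. spectral_point B \<mu>)" for \<mu>
  proof -
    have "spectral_point ?U \<mu> \<longleftrightarrow> (\<exists>J\<in>blocks ` branches_at v. eigenvalue_on J ?a \<mu>)"
      by (rule eigenvalue_on_decoupled[OF finU un uncoupled])
    then show ?thesis by simp
  qed
  have fin: "finite (blocks B)" if "B \<in> branches_at v" for B
    using branches_at_props(3)[OF that] finite_blocks by blast
  have ne: "blocks B \<noteq> {}" if "B \<in> branches_at v" for B
    using branches_at_props(2)[OF that] s_ge_1 by (auto simp: lessThan_empty_iff)
  obtain u where "u \<in> verts G" "u \<noteq> v" by (rule other_vertex)
  then have neU: "blocks ?U \<noteq> {}" using s_ge_1 by (auto simp: lessThan_empty_iff)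
  show le: "radius B \<le> radius ?U" if B: "B \<in> branches_at v" for B
  proof -
    obtain \<mu> where "spectral_point B \<mu>" "radius B = inverse (norm \<mu>)"
      unfolding radius_def by (rule inverse_radius_attained[OF fin[OF B] ne[OF B]])
    then show ?thesis
      using inverse_radius_ge[OF finU, of ?a \<mu>] dec B unfolding radius_def by auto
  qed
  obtain \<mu> where \<mu>: "spectral_point ?U \<mu>" "radius ?U = inverse (norm \<mu>)"
    unfolding radius_def by (rule inverse_radius_attained[OF finU neU])
  then obtain B where B: "B \<in> branches_at v" "spectral_point B \<mu>" using dec by auto
  have "radius ?U \<le> radius B"
    using inverse_radius_ge[OF fin[OF B(1)] B(2)] \<mu>(2) by (simp add: radius_def)
  then show "\<exists>B\<in>branches_at v. radius ?U = radius B" using le[OF B(1)] B(1) by force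
qed

lemma perron_branches_eq:
  assumes v: "v \<in> verts G"
  shows "perron_branches G s W vs v = perron_at v"
proof -
  have "perron_branches G s W vs v = {B \<in> branches_at v. radius B = radius (verts G - {v})}"
    unfolding perron_branches_def branches_eq[OF tree]
    using spectral_radii[OF v] by auto
  also have "\<dots> = perron_at v"
    using radius_of_all_branches[OF v] unfolding perron_at_def by (auto intro: antisym)
  finally show ?thesis .
qed

lemma characteristic_like_vertices_eq: "characteristic_like_vertices G s W vs = characteristic_set"
proof -
  have multi: "multi_perron G s W vs v \<longleftrightarrow> multi_perron_at v" for v
    unfolding multi_perron_def multi_perron_at_def using perron_branches_eq by auto
  have face: "facing_pair G s W vs u v \<longleftrightarrow> facing u v" for u v
  proof (cases "u \<rightarrow>\<^bsub>G\<^esub> v")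
    case True
    then have "u \<in> verts G" "v \<in> verts G" "u \<noteq> v" using adj_in_V adj_in_V2 adj_irrefl by auto
    then show ?thesis using True
      by (simp add: facing_pair_def facing_def edge_iff perron_branches_eq
          branch_of_eq_component[OF tree])
  next
    case False
    then show ?thesis by (simp add: facing_pair_def facing_def edge_iff)
  qed
  show ?thesis by (simp add: characteristic_like_vertices_def characteristic_set_def multi face)
qed

end

theorem mainTheorem2:
  fixes G :: "('v, 'e) pre_digraph"
    and s :: nat
    and W :: "'v set \<Rightarrow> real mat"
    and vs :: "'v list"
    and x :: 'v
  assumes "finite_tree G"
    and "2 \<le> card (verts G)"
    and "1 \<le> s"
    and "admissible_weights G s W"
    and "distinct vs" and "set vs = verts G"
    and "x \<in> verts G"
    and "x \<notin> characteristic_like_vertices G s W vs"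
  shows "\<exists>B. perron_branches G s W vs x = {B} \<and>
           characteristic_like_vertices G s W vs \<noteq> {} \<and>
           characteristic_like_vertices G s W vs \<subseteq> B"
proof -
  interpret weighted_tree_graph G s W vs by unfold_locales (use assms in auto)
  show ?thesis
    using perron_outside_characteristic_set assms(7,8)
    by (simp add: perron_branches_eq characteristic_like_vertices_eq)
qed

end
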